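(* Let $L,M\ge1$ be integers, let $p\in[0,1]$ be a probability and $q=1-p$, with $q\neq1$. Let $\mathcal{U}$ be the first passage time of the cycle trap process with parameters $(p,L,M)$, and for $\rho\in(0,1)$ let $\mathcal{T}_\rho$ be its first passage time under geometric restart with parameter $\rho$. Let $\tilde u(z)=\sum_{n\ge0}\mathbb{P}(\mathcal{U}=n)z^n=\frac{pz^L}{1-qz^{M+1}}$ and $$D=\frac{2\tilde u'(1)^2-\tilde u''(1)}{2}.$$ Then $\mathbb{E}[\mathcal{T}_\rho]$ is convex in $\rho$, and consequently there is some interval of values of $\rho$ in $(0,1)$ on which $\mathbb{E}[\mathcal{T}_\rho]<\mathbb{E}[\mathcal{U}]$ if and only if $D<0$; equivalently, $D<0$ if and only if there exists $\hat\rho\in(0,1)$ such that $\mathbb{E}[\mathcal{T}_\rho]<\mathbb{E}[\mathcal{U}]$ for all $\rho\in(0,\hat\rho)$. The condition $D<0$ is equivalent to $$(L+1)L+\frac{q}{p}(M+1)(2L-M)<0,$$ which is true exactly when $$p<p^*=\frac{(M+1)(M-2L)}{(M+1)(M-2L)+L(L+1)}.$$ The expression $p^*$ equals $0$ when $M=2L$ and increases monotonically towards $1$ as $M/L$ gets large. When $M/L>2$, $p^*$ is strictly greater than $0$, and there exists a range of values of $p$ for which restart can be beneficial (that is, for which $\mathbb{E}[\mathcal{T}_\rho]<\mathbb{E}[\mathcal{U}]$ for some $\rho$).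
   Context: Cycle trap process with parameters $(p,L,M)$: the state space is $\{-L,\ldots,M\}$, the process starts at $0$ and terminates at $-L$. From $0$ it moves to $-1$ with probability $p$ and to $1$ with probability $q=1-p$. From a state $-j$ with $1\le j<L$ it moves to $-j-1$ with probability $1$. From a state $j$ with $1\le j<M$ it moves to $j+1$ with probability $1$, and from $M$ it moves to $0$ with probability $1$. $\mathcal{U}$ is the hitting time of $-L$. Geometric restart with parameter $\rho\in(0,1)$: the restart time $\mathcal{R}$ is independent of $\mathcal{U}$ with $\mathbb{P}(\mathcal{R}=n)=\rho(1-\rho)^{n-1}$ for $n=1,2,3,\ldots$. The first passage time under restart $\mathcal{T}$ is defined recursively by $\mathcal{T}=\mathcal{U}$ if $\mathcal{R}>\mathcal{U}$ and $\mathcal{T}=\mathcal{R}+\mathcal{T}^*$ if $\mathcal{R}\le\mathcal{U}$, where $\mathcal{T}^*$ is a copy of $\mathcal{T}$ with the same distribution, independent of $(\mathcal{U},\mathcal{R})$ (ties count as restarts). Explicitly: let $(\mathcal{U}_k,\mathcal{R}_k)_{k\ge1}$ be i.i.d. copies of $(\mathcal{U},\mathcal{R})$ and $\kappa=\inf\{k\ge1:\mathcal{R}_k>\mathcal{U}_k\}$ (almost surely finite here); then $\mathcal{T}=\sum_{j<\kappa}\mathcal{R}_j+\mathcal{U}_\kappa$.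
   Formalization: Since p* is not a function of M/L alone (p*(100,349)>p*(2,7) though 3.49<3.5), "increases monotonically" is stated as: M/L<M'/L' implies p*(L,M)<p*(L',M') when M≥2L and M≤M'; the convergence of p* to 1 as M/L gets large is stated for all L,M. *)

theory Defs
  imports "HOL-Probability.Probability"
begin

section \<open>Markov chains on a countable state space\<close>

text \<open>
  The law on path space of the Markov chain with transition kernel \<open>K\<close> started at \<open>s\<close>,
  obtained from the Ionescu-Tulcea extension theorem.  It is characterised by
  \<open>emeasure_chain_law_cylinder\<close> below.
\<close>

definition chain_step :: "('s \<Rightarrow> 's pmf) \<Rightarrow> 's \<Rightarrow> nat \<Rightarrow> (nat \<Rightarrow> 's) \<Rightarrow> 's measure" where
  "chain_step K s n X = measure_pmf (case n of 0 \<Rightarrow> return_pmf s | Suc m \<Rightarrow> K (X m))"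

definition chain_law :: "('s :: countable \<Rightarrow> 's pmf) \<Rightarrow> 's \<Rightarrow> (nat \<Rightarrow> 's) measure" where
  "chain_law K s =
     projective_family.lim UNIV
       (Ionescu_Tulcea.CI (chain_step K s) (\<lambda>_. count_space UNIV)) (\<lambda>_. count_space UNIV)"

lemma Ionescu_Tulcea_chain:
  fixes K :: "'s :: countable \<Rightarrow> 's pmf"
  shows "Ionescu_Tulcea (chain_step K s) (\<lambda>_. count_space UNIV)"
proof (rule Ionescu_Tulcea.intro)
  fix i
  show "chain_step K s i \<in> PiM {0..<i} (\<lambda>_. count_space UNIV) \<rightarrow>\<^sub>M subprob_algebra (count_space UNIV)"
  proof (cases i)
    case 0
    have "(\<lambda>X :: nat \<Rightarrow> 's. measure_pmf (return_pmf s)) \<in>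
        PiM {0..<i} (\<lambda>_. count_space UNIV) \<rightarrow>\<^sub>M subprob_algebra (count_space UNIV)"
      by (rule measurable_const) (simp add: measure_pmf_in_subprob_algebra)
    then show ?thesis
      by (simp add: 0 chain_step_def[abs_def])
  next
    case (Suc m)
    have "(\<lambda>x. measure_pmf (K x)) \<in> count_space UNIV \<rightarrow>\<^sub>M subprob_algebra (count_space UNIV)"
      by (simp add: measure_pmf_in_subprob_algebra)
    moreover have "(\<lambda>X. X m) \<in> PiM {0..<i} (\<lambda>_. count_space UNIV) \<rightarrow>\<^sub>M count_space UNIV"
      by (rule measurable_component_singleton) (simp add: Suc)
    ultimately have "(\<lambda>X. measure_pmf (K (X m))) \<in>
        PiM {0..<i} (\<lambda>_. count_space UNIV) \<rightarrow>\<^sub>M subprob_algebra (count_space UNIV)"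
      by (rule measurable_compose_rev)
    then show ?thesis
      by (simp add: Suc chain_step_def[abs_def])
  qed
next
  fix i and X :: "nat \<Rightarrow> 's"
  show "prob_space (chain_step K s i X)"
    by (simp add: chain_step_def measure_pmf.prob_space_axioms)
qed

lemma sets_chain_law [simp, measurable_cong]:
  "sets (chain_law K s) = sets (PiM UNIV (\<lambda>_. count_space UNIV))"
proof -
  interpret Ionescu_Tulcea "chain_step K s" "\<lambda>_. count_space UNIV"
    by (rule Ionescu_Tulcea_chain)
  show ?thesis
    unfolding chain_law_def by simp
qed

lemma space_chain_law [simp]: "space (chain_law K s) = UNIV"
  using sets_eq_imp_space_eq[OF sets_chain_law] by (simp add: space_PiM)

lemma fun_upd_mem_PiE_singletons:
  assumes "X \<in> extensional {0..<n}"
  shows "X(n := y) \<in> PiE {0..<Suc n} (\<lambda>i. {x i}) \<longleftrightarrow> X \<in> PiE {0..<n} (\<lambda>i. {x i}) \<and> y = x n"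
proof -
  have "X(n := y) \<in> extensional {0..<Suc n}"
    using assms unfolding extensional_def by simp
  moreover have "(\<forall>i<Suc n. (X(n := y)) i = x i) \<longleftrightarrow> (\<forall>i<n. X i = x i) \<and> y = x n"
    unfolding less_Suc_eq by (metis fun_upd_apply less_irrefl)
  ultimately show ?thesis
    using assms by (simp only: PiE_iff Ball_def atLeastLessThan_iff singleton_iff le0 simp_thms)
qed

lemma emeasure_chain_law_cylinder:
  fixes K :: "'s :: countable \<Rightarrow> 's pmf"
  shows "emeasure (chain_law K s) {X. \<forall>i\<le>n. X i = x i} =
           (if x 0 = s then \<Prod>i<n. ennreal (pmf (K (x i)) (x (Suc i))) else 0)"
proof -
  interpret Ionescu_Tulcea "chain_step K s" "\<lambda>_. count_space UNIV"
    by (rule Ionescu_Tulcea_chain)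
  let ?S = "\<lambda>_ :: nat. count_space (UNIV :: 's set)"
  let ?A = "\<lambda>n. PiE {0..<Suc n} (\<lambda>i. {x i})"
  have A: "?A n \<in> sets (PiM {0..<Suc n} ?S)" for n
    by (rule sets_PiM_I_finite) auto
  have sp: "(\<lambda>_. undefined) \<in> space (PiM {0..<0} ?S)"
    by (simp add: space_PiM)
  have C: "emeasure (C 0 (Suc n) (\<lambda>_. undefined)) (?A n) =
      (if x 0 = s then \<Prod>i<n. ennreal (pmf (K (x i)) (x (Suc i))) else 0)" for n
  proof (induction n)
    case 0
    have "emeasure (C 0 (Suc 0) (\<lambda>_. undefined)) (?A 0) =
        emeasure (eP 0 (\<lambda>_. undefined)) (?A 0)"
      using bind_return[OF measurable_eP[of 0] sp] by simp
    also have "\<dots> = emeasure (chain_step K s 0 (\<lambda>_. undefined))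
        ((\<lambda>y. (\<lambda>_. undefined)(0 := y)) -` ?A 0 \<inter> space (?S 0))"
      by (rule emeasure_eP[OF sp A])
    also have "(\<lambda>y. (\<lambda>_. undefined)(0 := y)) -` ?A 0 \<inter> space (?S 0) = {x 0}"
      using fun_upd_mem_PiE_singletons[of "\<lambda>_. undefined" 0 _ x] by auto
    finally show ?case
      by (auto simp: chain_step_def emeasure_pmf_single)
  next
    case (Suc n)
    have step: "emeasure (eP (Suc n) X) (?A (Suc n)) =
        ennreal (pmf (K (x n)) (x (Suc n))) * indicator (?A n) X"
      if X: "X \<in> space (PiM {0..<Suc n} ?S)" for X
    proof -
      have "emeasure (eP (Suc n) X) (?A (Suc n)) =
          emeasure (chain_step K s (Suc n) X) ((\<lambda>y. X(Suc n := y)) -` ?A (Suc n) \<inter> space (?S 0))"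
        by (rule emeasure_eP[OF X A])
      also have "(\<lambda>y. X(Suc n := y)) -` ?A (Suc n) \<inter> space (?S 0) =
          (if X \<in> ?A n then {x (Suc n)} else {})"
        using fun_upd_mem_PiE_singletons[of X "Suc n" _ x] X
        by (auto simp: space_PiM PiE_def simp del: fun_upd_apply)
      also have "emeasure (chain_step K s (Suc n) X) (if X \<in> ?A n then {x (Suc n)} else {}) =
          ennreal (pmf (K (x n)) (x (Suc n))) * indicator (?A n) X"
        by (auto simp: chain_step_def emeasure_pmf_single PiE_iff)
      finally show ?thesis .
    qed
    have "emeasure (C 0 (Suc (Suc n)) (\<lambda>_. undefined)) (?A (Suc n)) =
        emeasure (C 0 (Suc n) (\<lambda>_. undefined) \<bind> eP (Suc n)) (?A (Suc n))"
      by simp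
    also have "\<dots> = (\<integral>\<^sup>+X. emeasure (eP (Suc n) X) (?A (Suc n)) \<partial>C 0 (Suc n) (\<lambda>_. undefined))"
    proof (rule emeasure_bind[OF _ _ A])
      show "space (C 0 (Suc n) (\<lambda>_. undefined)) \<noteq> {}"
        by (rule prob_space.not_empty[OF prob_space_C[OF sp]])
      have "sets (C 0 (Suc n) (\<lambda>_. undefined)) = sets (PiM {0..<Suc n} ?S)"
        using sets_C[OF sp, of "Suc n"] by (simp only: add_0)
      then show "eP (Suc n) \<in> C 0 (Suc n) (\<lambda>_. undefined) \<rightarrow>\<^sub>M
          subprob_algebra (PiM {0..<Suc (Suc n)} ?S)"
        using measurable_eP[of "Suc n"] by (subst measurable_cong_sets[OF _ refl])
    qed
    also have "\<dots> = (\<integral>\<^sup>+X. ennreal (pmf (K (x n)) (x (Suc n))) * indicator (?A n) X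
        \<partial>C 0 (Suc n) (\<lambda>_. undefined))"
      using space_C[OF sp, of "Suc n"] by (intro nn_integral_cong step) (simp only: add_0)
    also have "\<dots> = ennreal (pmf (K (x n)) (x (Suc n))) *
        emeasure (C 0 (Suc n) (\<lambda>_. undefined)) (?A n)"
      using A[of n] sets_C[OF sp, of "Suc n"]
      by (intro nn_integral_cmult_indicator) (simp only: add_0)
    finally show ?case
      unfolding Suc.IH by (simp add: mult.commute)
  qed
  have "{X. \<forall>i\<le>n. X i = x i} = PF.emb UNIV {0..<Suc n} (?A n)"
    by (auto simp: prod_emb_def space_PiM PiE_iff)
  then have "emeasure (chain_law K s) {X. \<forall>i\<le>n. X i = x i} = emeasure (CI {0..<Suc n}) (?A n)"
    unfolding chain_law_def using lim[OF _ A] by simp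
  also have "\<dots> = emeasure (C 0 (Suc n) (\<lambda>_. undefined)) (PF.emb {0..<Suc n} {0..<Suc n} (?A n))"
    by (rule emeasure_CI[OF subset_refl A])
  also have "PF.emb {0..<Suc n} {0..<Suc n} (?A n) = ?A n"
    by (auto simp: prod_emb_def space_PiM PiE_iff)
  finally show ?thesis
    using C by simp
qed


section \<open>The cycle trap process and its first passage time\<close>

text \<open>
  Termination at \<open>-L\<close> is modelled by making \<open>-L\<close> absorbing.  States outside \<open>{-L..M}\<close>
  are never reached from \<open>0\<close>; the kernel is total only because the state type is \<open>int\<close>.
\<close>

definition trap_kernel :: "real \<Rightarrow> nat \<Rightarrow> nat \<Rightarrow> int \<Rightarrow> int pmf" where
  "trap_kernel p L M x =
     (if x = 0 then map_pmf (\<lambda>b. if b then -1 else 1) (bernoulli_pmf p)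
      else if x < 0 then return_pmf (if x \<le> - int L then x else x - 1)
      else return_pmf (if x < int M then x + 1 else 0))"

definition trap_process :: "real \<Rightarrow> nat \<Rightarrow> nat \<Rightarrow> (nat \<Rightarrow> int) measure" where
  "trap_process p L M = chain_law (trap_kernel p L M) 0"

definition hitting_time :: "'s \<Rightarrow> (nat \<Rightarrow> 's) \<Rightarrow> enat" where
  "hitting_time a X = (INF n \<in> {n. X n = a}. enat n)"

definition passage_time :: "nat \<Rightarrow> (nat \<Rightarrow> int) \<Rightarrow> enat" where
  "passage_time L = hitting_time (- int L)"

definition passage_prob :: "real \<Rightarrow> nat \<Rightarrow> nat \<Rightarrow> nat \<Rightarrow> real" where
  "passage_prob p L M n = measure (trap_process p L M) {X. passage_time L X = enat n}"

definition expected_passage :: "real \<Rightarrow> nat \<Rightarrow> nat \<Rightarrow> ennreal" where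
  "expected_passage p L M = (\<integral>\<^sup>+X. ennreal_of_enat (passage_time L X) \<partial>trap_process p L M)"

definition passage_pgf :: "real \<Rightarrow> nat \<Rightarrow> nat \<Rightarrow> real \<Rightarrow> real" where
  "passage_pgf p L M z = (\<Sum>n. passage_prob p L M n * z ^ n)"

definition restart_coeff :: "real \<Rightarrow> nat \<Rightarrow> nat \<Rightarrow> real" where
  "restart_coeff p L M =
     (2 * (deriv (passage_pgf p L M) 1)\<^sup>2 - (deriv ^^ 2) (passage_pgf p L M) 1) / 2"


section \<open>Geometric restart\<close>

text \<open>
  The library's \<open>geometric_pmf\<close> counts failures and so starts at \<open>0\<close>; the restart time starts at \<open>1\<close>.
\<close>

definition restart_pmf :: "real \<Rightarrow> nat pmf" where
  "restart_pmf \<rho> = map_pmf Suc (geometric_pmf \<rho>)"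

lemma pmf_restart:
  assumes "0 < \<rho>" "\<rho> \<le> 1" "1 \<le> n"
  shows "pmf (restart_pmf \<rho>) n = \<rho> * (1 - \<rho>) ^ (n - 1)"
proof -
  obtain m where n: "n = Suc m"
    using assms(3) by (cases n) auto
  have "pmf (restart_pmf \<rho>) (Suc m) = pmf (geometric_pmf \<rho>) m"
    unfolding restart_pmf_def by (rule pmf_map_inj') simp
  then show ?thesis
    using assms by (simp add: n mult.commute)
qed

text \<open>
  \<open>\<omega> k\<close> is the pair (passage time, restart time) of attempt \<open>k\<close>.  Attempts are numbered from \<open>0\<close>,
  so \<open>\<kappa>\<close> below is one less than the usual one; if every attempt is restarted the value is \<open>\<infinity>\<close>.
\<close>

definition restarted_time :: "(nat \<Rightarrow> enat \<times> nat) \<Rightarrow> enat" where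
  "restarted_time \<omega> =
     (if \<exists>k. enat (snd (\<omega> k)) > fst (\<omega> k)
      then let \<kappa> = (LEAST k. enat (snd (\<omega> k)) > fst (\<omega> k))
           in (\<Sum>j<\<kappa>. enat (snd (\<omega> j))) + fst (\<omega> \<kappa>)
      else \<infinity>)"

definition restart_space ::
    "real \<Rightarrow> nat \<Rightarrow> nat \<Rightarrow> real \<Rightarrow> (nat \<Rightarrow> (nat \<Rightarrow> int) \<times> nat) measure" where
  "restart_space p L M \<rho> =
     PiM UNIV (\<lambda>_. trap_process p L M \<Otimes>\<^sub>M measure_pmf (restart_pmf \<rho>))"

definition expected_restarted :: "real \<Rightarrow> nat \<Rightarrow> nat \<Rightarrow> real \<Rightarrow> ennreal" where
  "expected_restarted p L M \<rho> =
     (\<integral>\<^sup>+\<omega>. ennreal_of_enat (restarted_time (\<lambda>k. (passage_time L (fst (\<omega> k)), snd (\<omega> k))))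
        \<partial>restart_space p L M \<rho>)"


section \<open>The critical probability\<close>

text \<open>
  The denominator equals \<open>(M - L) * (M - L + 1)\<close>: it is positive unless \<open>M = L\<close> or \<open>M + 1 = L\<close>,
  where \<open>x / 0 = 0\<close> gives \<open>p_star L M = 0\<close>.  The numerator is then negative, so the value \<open>0\<close> is
  a harmless stand-in for the degenerate fraction: \<open>p < p_star L M\<close> fails for all \<open>p \<ge> 0\<close>.
\<close>

definition p_star :: "nat \<Rightarrow> nat \<Rightarrow> real" where
  "p_star L M =
     ((real M + 1) * (real M - 2 * real L)) /
     ((real M + 1) * (real M - 2 * real L) + real L * (real L + 1))"

end

(* Unrolling the restart recursion gives E[T] = E[min(U, R)] / P(R > U) = (1/u(r) - 1) / (1 - r)
   with r = 1 - rho and u the generating function of U.  Since p + q = 1, dividing out 1 - r leaves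
   the sum of r^(j-L) over j < L plus q/p times the sum of r^(j-L) over j <= M.  The exponents are
   integers and the coefficients nonnegative, so this is convex in rho.  At rho = 0 its value is
   E[U] and its slope is D, and a convex function drops below its value at 0 somewhere on the right
   iff its slope there is negative. *)
theory Submission
  imports Defs
begin

section \<open>The expected restarted time as a sum of powers\<close>

text \<open>Real powers are used because the exponents \<open>j - L\<close> can be negative. No
  \<rho> is left in a denominator, so the formula makes sense on the whole half-line \<rho> < 1;
  thus 0 is an interior point and has a two-sided tangent, although the restart problem itself lives
  on (0,1). Integer exponents are essential: (1 - \<rho>)^a fails to be convex exactly for 0 < a <
  1, and positive exponents do occur when M > L. The law of U is found without classifying paths.
  For each number k of completed cycles one explicit path is exhibited, and the masses of these
  paths already sum to 1 when p > 0; lower bounds for the point masses therefore determine the law,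
  and U is almost surely finite. The recursion for T is unrolled pathwise into a series over
  attempts. Its expectation is taken in the extended nonnegative reals, where exchanging sum and
  integral needs no finiteness known in advance. Independence makes the series geometric with ratio
  P(R \<le> U) = 1 - u(r).\<close>

definition restart_mean :: "real \<Rightarrow> nat \<Rightarrow> nat \<Rightarrow> real \<Rightarrow> real" where
  "restart_mean p L M \<rho> =
     (\<Sum>j<L. (1 - \<rho>) powr (real j - real L))
     + (1 - p) / p * (\<Sum>j<M + 1. (1 - \<rho>) powr (real j - real L))"

text \<open>The second derivative a(a - 1)(1 - x)^(a - 2) is nonnegative as soon as a lies outside
  (0,1).\<close>

lemma convex_on_one_minus_powr:
  assumes "a \<le> 0 \<or> 1 \<le> a"
  shows "convex_on {..<1} (\<lambda>x::real. (1 - x) powr a)"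
proof (rule f''_ge0_imp_convex)
  fix x :: real
  assume "x \<in> {..<1}"
  then have x: "0 < 1 - x" by simp
  show "((\<lambda>x. (1 - x) powr a) has_real_derivative - a * (1 - x) powr (a - 1)) (at x)"
    using x by (auto intro!: derivative_eq_intros)
  show "((\<lambda>x. - a * (1 - x) powr (a - 1)) has_real_derivative
      a * (a - 1) * (1 - x) powr (a - 2)) (at x)"
    using x by (auto intro!: derivative_eq_intros simp: algebra_simps)
  have "0 \<le> a * (a - 1)"
    using assms by (auto simp: zero_le_mult_iff)
  then show "0 \<le> a * (a - 1) * (1 - x) powr (a - 2)"
    by simp
qed simp

lemma convex_on_sum_fun:
  fixes f :: "'i \<Rightarrow> 'a::real_vector \<Rightarrow> real"
  assumes "convex S" and "\<And>i. i \<in> I \<Longrightarrow> convex_on S (f i)"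
  shows "convex_on S (\<lambda>x. \<Sum>i\<in>I. f i x)"
  using assms(2)
proof (induction I rule: infinite_finite_induct)
  case (insert i I)
  then show ?case by (simp add: convex_on_add)
qed (simp_all add: assms(1) convex_on_const)

lemma convex_on_restart_mean:
  assumes "0 < p" "p \<le> 1"
  shows "convex_on {..<1} (restart_mean p L M)"
proof -
  have *: "convex_on {..<1} (\<lambda>\<rho>::real. (1 - \<rho>) powr (real j - real L))" for j
  proof (rule convex_on_one_minus_powr)
    \<comment> \<open>A difference of integers cannot fall strictly between 0 and 1.\<close>
    have "j \<le> L \<or> L + 1 \<le> j" by linarith
    then show "real j - real L \<le> 0 \<or> 1 \<le> real j - real L" by auto
  qed
  show ?thesis
    unfolding restart_mean_def[abs_def] using assms
    by (intro convex_on_add convex_on_cmul convex_on_sum_fun *) auto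
qed

lemma restart_mean_at_0: "restart_mean p L M 0 = real L + (1 - p) / p * (real M + 1)"
  by (simp add: restart_mean_def)

lemma sum_diff_lessThan:
  "(\<Sum>j<n. c - real j) = real n * c - real n * (real n - 1) / 2"
  by (induction n) (simp_all add: field_simps)

text \<open>Differentiating (1 - \<rho>)^(j - L) at 0 leaves L - j, so the slope combines two
  arithmetic sums, L(L + 1)/2 and (M + 1)(2L - M)/2. \<open>restart_coeff_eq\<close> identifies the
  result with D.\<close>

lemma restart_mean_has_derivative_at_0:
  "(restart_mean p L M has_real_derivative
     ((real L + 1) * real L + (1 - p) / p * (real M + 1) * (2 * real L - real M)) / 2) (at 0)"
proof -
  have *: "((\<lambda>\<rho>. \<Sum>j<n. (1 - \<rho>) powr (real j - real L)) has_real_derivative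
      (\<Sum>j<n. real L - real j)) (at 0)" for n
    by (rule DERIV_sum) (auto intro!: derivative_eq_intros)
  have D: "(restart_mean p L M has_real_derivative
      (\<Sum>j<L. real L - real j) + (1 - p) / p * (\<Sum>j<M + 1. real L - real j)) (at 0)"
    unfolding restart_mean_def[abs_def]
    by (intro DERIV_add DERIV_cmult *)
  have "(\<Sum>j<L. real L - real j) + c * (\<Sum>j<M + 1. real L - real j) =
      ((real L + 1) * real L + c * (real M + 1) * (2 * real L - real M)) / 2" for c
    unfolding sum_diff_lessThan by (simp add: algebra_simps add_divide_distrib diff_divide_distrib)
  with D show ?thesis by (simp only:)
qed

lemma sum_powr_geometric:
  assumes "0 < r" "r \<noteq> (1::real)"
  shows "(\<Sum>j<n. r powr (real j - real L)) = (1 - r ^ n) / ((1 - r) * r ^ L)"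
proof -
  have "(\<Sum>j<n. r powr (real j - real L)) = (\<Sum>j<n. r ^ j) / r ^ L"
    using assms by (simp add: powr_diff powr_realpow sum_divide_distrib)
  also have "(\<Sum>j<n. r ^ j) = (1 - r ^ n) / (1 - r)"
    using assms by (simp add: sum_gp_strict)
  finally show ?thesis by simp
qed

text \<open>With R = r^L, S = r^(M+1) and q = 1 - p, the numerator of 1 - u is 1 - qS - pR = p(1 -
  R) + q(1 - S). Dividing by \<rho> p R separates the two geometric sums.\<close>

lemma restart_mean_eq:
  assumes p: "0 < p" "p \<le> 1" and \<rho>: "0 < \<rho>" "\<rho> < 1"
    and u: "u = p * (1 - \<rho>) ^ L / (1 - (1 - p) * (1 - \<rho>) ^ (M + 1))"
  shows "(1 - u) / (\<rho> * u) = restart_mean p L M \<rho>"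
proof -
  define r where "r = 1 - \<rho>"
  define R where "R = r ^ L"
  define S where "S = r ^ (M + 1)"
  have r: "0 < r" "r < 1" using \<rho> by (auto simp: r_def)
  have R: "0 < R" using r by (simp add: R_def)
  have "S < 1" "0 \<le> S" using r by (auto simp: S_def simp del: power_Suc intro!: power_Suc_less_one)
  then have "(1 - p) * S < 1"
    using p mult_le_cancel_right1[of "1 - p" S] by (smt (verit) mult_le_one mult_left_le_one_le)
  then have d: "0 < 1 - (1 - p) * S" by simp
  have u': "u = p * R / (1 - (1 - p) * S)"
    using u by (simp add: R_def S_def r_def)
  have "restart_mean p L M \<rho> =
      (1 - R) / (\<rho> * R) + (1 - p) / p * ((1 - S) / (\<rho> * R))"
    unfolding restart_mean_def r_def[symmetric] using r
    by (subst (1 2) sum_powr_geometric) (auto simp: R_def S_def r_def)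
  also have "\<dots> = (1 - u) / (\<rho> * u)"
    unfolding u' using d p R \<rho> by (simp add: divide_simps) (simp add: algebra_simps)
  finally show ?thesis ..
qed

section \<open>The critical probability\<close>

text \<open>The factors are consecutive integers, which is why the denominator is never
  negative.\<close>

lemma p_star_denominator:
  "(real M + 1) * (real M - 2 * real L) + real L * (real L + 1) =
     (real M - real L) * (real M - real L + 1)"
  by (simp add: algebra_simps)

text \<open>Multiplied by p, the left-hand expression becomes p(A + B) - A, where A is the numerator
  of \<open>p_star\<close> and A + B its denominator. As A + B is nonnegative, only its vanishing
  stands in the way of dividing.\<close>

lemma critical_iff_less_p_star:
  assumes p: "0 < p" "1 \<le> L"
  shows "(real L + 1) * real L + (1 - p) / p * (real M + 1) * (2 * real L - real M) < 0
      \<longleftrightarrow> p < p_star L M"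
proof -
  define A where "A = (real M + 1) * (real M - 2 * real L)"
  define B where "B = real L * (real L + 1)"
  have B: "0 < B" using p by (simp add: B_def)
  have "A + B = real_of_int ((int M - int L) * (int M - int L + 1))"
    unfolding A_def B_def p_star_denominator by simp
  moreover have "0 \<le> (int M - int L) * (int M - int L + 1)"
    by (cases "int M < int L") (auto simp: zero_le_mult_iff)
  ultimately have AB: "0 \<le> A + B" by (metis of_int_0_le_iff)
  have "(real L + 1) * real L + (1 - p) / p * (real M + 1) * (2 * real L - real M) =
      (p * (A + B) - A) / p"
    using p by (simp add: A_def B_def field_simps)
  also have "\<dots> < 0 \<longleftrightarrow> p * (A + B) < A"
    using p by (simp add: divide_less_0_iff)
  also have "\<dots> \<longleftrightarrow> p < A / (A + B)"
  proof (cases "A + B = 0")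
    \<comment> \<open>Both sides are false here: A = -B < 0, while the quotient is 0 by convention
      and p > 0.\<close>
    case True
    then have "A < 0" using B by simp
    then show ?thesis using p by (simp add: True)
  next
    case False
    then have "0 < A + B" using AB by simp
    then show ?thesis by (simp add: pos_less_divide_eq)
  qed
  finally show ?thesis by (simp add: p_star_def A_def B_def)
qed

text \<open>This exhibits \<open>p_star\<close> as an increasing function of the single quantity
  A/B, so monotonicity and the limit 1 reduce to statements about A/B. The bound
  \<open>2 * l \<le> m\<close> makes A/B nonnegative.\<close>

lemma p_star_eq_inverse:
  assumes "1 \<le> l" "2 * l \<le> m"
  shows "1 - p_star l m = 1 / (1 + (real m + 1) * (real m - 2 * real l) / (real l * (real l + 1)))"
proof -
  have l: "real l > 0" using assms by simp
  then have B: "0 < real l * (real l + 1)" by simp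
  have A: "0 \<le> (real m + 1) * (real m - 2 * real l)" using assms by simp
  have "1 - a / (a + b) = 1 / (1 + a / b)" if "0 \<le> a" "0 < b" for a b :: real
    using that by (simp add: field_simps add_pos_nonneg)
  from this[OF A B] show ?thesis unfolding p_star_def .
qed

text \<open>A/B factors as (m + 1)/(l + 1) times m/l - 2. The second factor grows strictly with the
  ratio; the work is to show that the first does not decrease.\<close>

lemma p_star_strict_mono:
  assumes l: "1 \<le> l" "1 \<le> l'" and m: "2 * l \<le> m" "m \<le> m'"
    and ratio: "real m / real l < real m' / real l'"
  shows "p_star l m < p_star l' m'"
proof -
  define f where "f = (\<lambda>l m :: nat. (real m + 1) * (real m - 2 * real l) / (real l * (real l + 1)))"
  have f: "f l m = (real m + 1) / (real l + 1) * (real m / real l - 2)"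
    if "1 \<le> l" for l m :: nat
    using that by (simp add: f_def field_simps)
  have lr: "0 < real l" "0 < real l'" using l by auto
  have cross: "real m * real l' < real m' * real l"
    using ratio lr by (simp add: field_simps)
  have two: "2 \<le> real m / real l"
    using m lr by (simp add: field_simps)
  then have "2 < real m' / real l'" using ratio by linarith
  then have m': "2 * l' \<le> m'" using lr by (simp add: field_simps)
  \<comment> \<open>This is what remains of comparing (m + 1)/(l + 1) with (m' + 1)/(l' + 1) after
    cross-multiplying and cancelling the products, which \<open>cross\<close> controls. If l' \<le>
    l, it follows from \<open>m \<le> m'\<close>; otherwise l \<le> m and \<open>cross\<close> force
    m to grow at least as much as l.\<close>
  have "real m + real l' \<le> real m' + real l"
  proof (cases "l' \<le> l")
    case True
    then show ?thesis using m by simp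
  next
    case False
    have "(real l' - real l) * real l \<le> (real l' - real l) * real m"
      using False m by (intro mult_left_mono) auto
    also have "\<dots> \<le> (real m' - real m) * real l"
      using cross by (simp add: algebra_simps)
    finally have "real l' - real l \<le> real m' - real m"
      using lr by simp
    then show ?thesis by simp
  qed
  then have "(real m + 1) * (real l' + 1) \<le> (real m' + 1) * (real l + 1)"
    using cross by (simp add: algebra_simps)
  then have le: "(real m + 1) / (real l + 1) \<le> (real m' + 1) / (real l' + 1)"
    by (simp add: divide_simps mult.commute)
  have "f l m \<le> (real m' + 1) / (real l' + 1) * (real m / real l - 2)"
    unfolding f[OF l(1)] using two by (intro mult_right_mono le) simp
  also have "\<dots> < f l' m'"
    unfolding f[OF l(2)] using ratio by (intro mult_strict_left_mono) (simp_all add: add_nonneg_pos)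
  finally have "f l m < f l' m'" .
  moreover have "0 \<le> f l m"
    using m lr by (simp add: f_def)
  ultimately have "1 / (1 + f l' m') < 1 / (1 + f l m)"
    by (intro divide_strict_left_mono) auto
  then show ?thesis
    using p_star_eq_inverse[OF l(1) m(1)] p_star_eq_inverse[OF l(2) m'] by (simp add: f_def)
qed

lemma p_star_less_one:
  assumes "1 \<le> l" "2 * l \<le> m"
  shows "p_star l m < 1"
proof -
  have "0 \<le> (real m + 1) * (real m - 2 * real l) / (real l * (real l + 1))"
    using assms by simp
  then have "0 < 1 - p_star l m"
    unfolding p_star_eq_inverse[OF assms] by (simp add: add_pos_nonneg)
  then show ?thesis by simp
qed

lemma p_star_pos:
  assumes "1 \<le> l" "2 * l < m"
  shows "0 < p_star l m"
proof -
  have "0 < (real m + 1) * (real m - 2 * real l)" "0 < real l * (real l + 1)"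
    using assms by simp_all
  then show ?thesis unfolding p_star_def by (simp add: add_pos_pos)
qed

text \<open>Since m \<ge> l, the factor (m + 1)/(l + 1) is at least 1, so A/B \<ge> m/l - 2 \<ge>
  1/\<epsilon>; hence the threshold 2 + 1/\<epsilon>. Then 1 - p* = 1/(1 + A/B) <
  \<epsilon>.\<close>

lemma p_star_near_one:
  assumes "0 < \<epsilon>" "1 \<le> l" "2 + 1 / \<epsilon> \<le> real m / real l"
  shows "2 * l \<le> m" "1 - \<epsilon> < p_star l m"
proof -
  have l: "0 < real l" using assms by simp
  have "0 < 1 / \<epsilon>" using assms by simp
  then have "2 \<le> real m / real l" using assms(3) by linarith
  then show m: "2 * l \<le> m" using l by (simp add: field_simps)
  have "1 / \<epsilon> \<le> real m / real l - 2" using assms(3) by linarith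
  also have "\<dots> = 1 * (real m / real l - 2)" by simp
  also have "\<dots> \<le> (real m + 1) / (real l + 1) * (real m / real l - 2)"
    using m l \<open>2 \<le> real m / real l\<close> by (intro mult_right_mono) (auto simp: field_simps)
  also have "\<dots> = (real m + 1) * (real m - 2 * real l) / (real l * (real l + 1))" (is "_ = ?f")
    using l by (simp add: field_simps)
  finally have f: "1 / \<epsilon> \<le> ?f" .
  have "1 / (1 + ?f) < 1 / (1 / \<epsilon>)"
    using f \<open>0 < 1 / \<epsilon>\<close> by (intro divide_strict_left_mono mult_pos_pos) linarith+
  then show "1 - \<epsilon> < p_star l m"
    using p_star_eq_inverse[OF assms(2) m] by simp
qed

section \<open>The law of the passage time\<close>

text \<open>The whole path space is the cylinder over the empty index set, whose base is a one-point
  probability space.\<close>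

lemma prob_space_chain_law: "prob_space (chain_law K s)"
proof -
  interpret Ionescu_Tulcea "chain_step K s" "\<lambda>_. count_space UNIV"
    by (rule Ionescu_Tulcea_chain)
  have "emeasure PF.lim (PF.emb UNIV {} {\<lambda>_. undefined}) = emeasure (CI {}) {\<lambda>_. undefined}"
    by (rule lim) (auto simp: sets_PiM_empty)
  also have "\<dots> = 1"
    using prob_space.emeasure_space_1[OF PF.prob_space_P[of "{}"]]
    by (simp add: space_PiM PF.space_P)
  also have "PF.emb UNIV {} {\<lambda>_. undefined} = (UNIV :: (nat \<Rightarrow> 'a) set)"
    by (auto simp: prod_emb_def space_PiM restrict_def)
  finally have "emeasure (chain_law K s) (space (chain_law K s)) = 1"
    by (simp add: chain_law_def space_PiM)
  then show ?thesis by (rule prob_spaceI)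
qed

section \<open>Hitting times and their measurability\<close>

lemma hitting_time_eq_Least:
  assumes "X k = a"
  shows "hitting_time a X = enat (LEAST n. X n = a)"
  unfolding hitting_time_def
proof (rule antisym)
  show "(INF n\<in>{n. X n = a}. enat n) \<le> enat (LEAST n. X n = a)"
    using LeastI[of "\<lambda>n. X n = a" k] assms by (auto intro: INF_lower)
  show "enat (LEAST n. X n = a) \<le> (INF n\<in>{n. X n = a}. enat n)"
    by (rule INF_greatest) (simp add: Least_le)
qed

lemma hitting_time_eq_enat_iff:
  "hitting_time a X = enat n \<longleftrightarrow> X n = a \<and> (\<forall>m<n. X m \<noteq> a)"
proof (cases "\<exists>k. X k = a")
  case True
  then obtain k where k: "X k = a" ..
  have "(LEAST i. X i = a) = n \<longleftrightarrow> X n = a \<and> (\<forall>m<n. X m \<noteq> a)"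
    using LeastI[of "\<lambda>i. X i = a", OF k] not_less_Least[of _ "\<lambda>i. X i = a"]
      Least_equality[of "\<lambda>i. X i = a" n] not_less by blast
  then show ?thesis
    by (simp add: hitting_time_eq_Least[of X k a, OF k])
next
  case False
  then have "{n. X n = a} = {}" by simp
  then show ?thesis using False by (simp add: hitting_time_def top_enat_def)
qed

lemma hitting_time_eq_infinity_iff: "hitting_time a X = \<infinity> \<longleftrightarrow> (\<forall>n. X n \<noteq> a)"
proof (cases "\<exists>k. X k = a")
  case True
  then show ?thesis using hitting_time_eq_Least[of X _ a] by auto
next
  case False
  then have "{n. X n = a} = {}" by simp
  then show ?thesis using False by (simp add: hitting_time_def top_enat_def)
qed

lemma measurable_hitting_time:
  "hitting_time a \<in> PiM UNIV (\<lambda>_. count_space UNIV) \<rightarrow>\<^sub>M count_space UNIV"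
proof -
  let ?P = "PiM (UNIV :: nat set) (\<lambda>_. count_space (UNIV :: 'a set))"
  have [measurable]: "Measurable.pred ?P (\<lambda>X. X n = a)" for n
    by measurable
  have "hitting_time a -` {t} \<inter> space ?P \<in> sets ?P" for t
  proof (cases t)
    case (enat n)
    have "{X \<in> space ?P. X n = a \<and> (\<forall>m<n. X m \<noteq> a)} \<in> sets ?P"
      by measurable
    also have "{X \<in> space ?P. X n = a \<and> (\<forall>m<n. X m \<noteq> a)} = hitting_time a -` {t} \<inter> space ?P"
      using enat by (auto simp: hitting_time_eq_enat_iff)
    finally show ?thesis .
  next
    case infinity
    have "{X \<in> space ?P. \<forall>n. X n \<noteq> a} \<in> sets ?P"
      by measurable
    also have "{X \<in> space ?P. \<forall>n. X n \<noteq> a} = hitting_time a -` {t} \<inter> space ?P"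
      using infinity by (auto simp: hitting_time_eq_infinity_iff)
    finally show ?thesis .
  qed
  then show ?thesis
    by (simp add: measurable_count_space_eq2_countable)
qed

lemma sets_trap_process [simp, measurable_cong]:
  "sets (trap_process p L M) = sets (PiM UNIV (\<lambda>_. count_space UNIV))"
  by (simp add: trap_process_def)

lemma space_trap_process [simp]: "space (trap_process p L M) = UNIV"
  by (simp add: trap_process_def)

lemma prob_space_trap_process: "prob_space (trap_process p L M)"
  unfolding trap_process_def by (rule prob_space_chain_law)

lemma measurable_passage_time [measurable]:
  "passage_time L \<in> trap_process p L' M \<rightarrow>\<^sub>M count_space UNIV"
  unfolding passage_time_def measurable_cong_sets[OF sets_trap_process refl]
  by (rule measurable_hitting_time)

text \<open>Pointwise domination of the masses suffices, since both total masses are 1.\<close>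

lemma prob_space_eq_pmfI:
  fixes P :: "'a :: countable pmf"
  assumes N: "prob_space N" "sets N = UNIV"
    and le: "\<And>x. emeasure P {x} \<le> emeasure N {x}"
  shows "N = measure_pmf P"
proof -
  interpret prob_space N by fact
  have sp: "space N = UNIV" using N sets_eq_imp_space_eq[of N "count_space UNIV"] by simp
  have mono: "emeasure P A \<le> emeasure N A" for A
  proof -
    have "emeasure P A = (\<integral>\<^sup>+x. emeasure P {x} \<partial>count_space A)"
      by (rule emeasure_countable_singleton) auto
    also have "\<dots> \<le> (\<integral>\<^sup>+x. emeasure N {x} \<partial>count_space A)"
      by (intro nn_integral_mono le)
    also have "\<dots> = emeasure N A"
      by (rule emeasure_countable_singleton[symmetric]) (auto simp: N)
    finally show ?thesis .
  qed
  have mono': "measure_pmf.prob P A \<le> prob A" for A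
    using mono[of A] by (simp add: measure_pmf.emeasure_eq_measure emeasure_eq_measure)
  show ?thesis
  proof (rule measure_eqI)
    fix A
    have "prob (- A) = 1 - prob A"
      using prob_compl[of A] by (simp add: sp N Compl_eq_Diff_UNIV)
    moreover have "measure_pmf.prob P (- A) = 1 - measure_pmf.prob P A"
      using measure_pmf.prob_compl[of A P] by (simp add: Compl_eq_Diff_UNIV)
    ultimately have "prob A = measure_pmf.prob P A"
      using mono'[of A] mono'[of "- A"] by linarith
    then show "emeasure N A = emeasure P A"
      by (simp add: measure_pmf.emeasure_eq_measure emeasure_eq_measure)
  qed (simp add: N)
qed

text \<open>The path making \<open>k\<close> excursions around the cycle before falling into the trap.\<close>

definition trap_path :: "nat \<Rightarrow> nat \<Rightarrow> nat \<Rightarrow> int" where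
  "trap_path M k i =
     (if i < k * (M + 1) then int (i mod (M + 1)) else int (k * (M + 1)) - int i)"

lemma prod_lessThan_add:
  fixes f :: "nat \<Rightarrow> 'a::comm_monoid_mult"
  shows "(\<Prod>i<m + n. f i) = (\<Prod>i<m. f i) * (\<Prod>i<n. f (m + i))"
  by (induction n) (simp_all add: mult.assoc)

lemma prod_mod_eq_power:
  fixes c :: "'a::comm_monoid_mult"
  assumes "0 < d"
  shows "(\<Prod>i<k * d. if i mod d = 0 then c else 1) = c ^ k"
proof (induction k)
  case (Suc k)
  have "(\<Prod>i<d. if (k * d + i) mod d = 0 then c else 1) = (\<Prod>i<d. if i = 0 then c else 1)"
    by (rule prod.cong) auto
  also have "\<dots> = c"
    using assms by (simp add: prod.delta)
  finally show ?case
    using prod_lessThan_add[of "\<lambda>i. if i mod d = 0 then c else 1" "k * d" d] Suc.IH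
    by (simp add: add.commute mult.commute)
qed simp

lemma pmf_trap_kernel_0:
  assumes "0 \<le> p" "p \<le> 1"
  shows "pmf (trap_kernel p L M 0) (-1) = p" "pmf (trap_kernel p L M 0) 1 = 1 - p"
proof -
  have "inj (\<lambda>b. if b then -1 else 1 :: int)" by (auto simp: inj_def)
  from pmf_map_inj'[OF this, of "bernoulli_pmf p" True] pmf_map_inj'[OF this, of "bernoulli_pmf p" False]
  show "pmf (trap_kernel p L M 0) (-1) = p" "pmf (trap_kernel p L M 0) 1 = 1 - p"
    using assms by (simp_all add: trap_kernel_def)
qed

text \<open>Chance enters only at visits to 0: each of the k cycles contributes one factor 1 - p,
  the final departure contributes p, and all other steps are deterministic.\<close>

lemma prod_trap_path:
  assumes p: "0 \<le> p" "p \<le> 1" and LM: "1 \<le> L" "1 \<le> M"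
  shows "(\<Prod>i<L + k * (M + 1). pmf (trap_kernel p L M (trap_path M k i)) (trap_path M k (Suc i))) =
           p * (1 - p) ^ k"
proof -
  define K where "K = M + 1"
  define f where "f i = pmf (trap_kernel p L M (trap_path M k i)) (trap_path M k (Suc i))" for i
  have "f i = (if i mod K = 0 then 1 - p else 1)" if i: "i < k * K" for i
  proof -
    have a: "trap_path M k i = int (i mod K)"
      using i by (simp add: trap_path_def K_def)
    have "trap_path M k (Suc i) = int (Suc i mod K)"
    proof (cases "Suc i < k * K")
      case False
      \<comment> \<open>The end of the last cycle is already described by the descending branch of
        \<open>trap_path\<close>; both branches give 0 there.\<close>
      then have "Suc i = k * K" using i by simp
      then show ?thesis unfolding trap_path_def K_def[symmetric] by simp
    qed (simp add: trap_path_def K_def)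
    then have b: "trap_path M k (Suc i) = (if i mod K = M then 0 else int (i mod K) + 1)"
      by (simp add: mod_Suc K_def)
    have "i mod K \<le> M" by (simp add: K_def less_Suc_eq_le[symmetric])
    then show ?thesis
      using LM pmf_trap_kernel_0[OF p, of L M] unfolding f_def a b
      by (auto simp: trap_kernel_def)
  qed
  then have 1: "(\<Prod>i<k * K. f i) = (1 - p) ^ k"
    using prod_mod_eq_power[of K "1 - p" k] by (simp add: K_def)
  have "f (k * K + i) = (if i = 0 then p else 1)" if "i < L" for i
  proof -
    have "trap_path M k (k * K + i) = - int i" "trap_path M k (Suc (k * K + i)) = - int i - 1"
      by (simp_all add: trap_path_def K_def)
    then show ?thesis
      using that pmf_trap_kernel_0[OF p, of L M] by (auto simp: f_def trap_kernel_def)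
  qed
  then have 2: "(\<Prod>i<L. f (k * K + i)) = p"
    using LM by (simp add: prod.delta)
  have "(\<Prod>i<k * K + L. f i) = p * (1 - p) ^ k"
    unfolding prod_lessThan_add 1 2 by simp
  then show ?thesis by (simp add: f_def K_def add.commute)
qed

text \<open>During the cycles the path is nonnegative, so L \<ge> 1 excludes an early hit; the
  descent then takes exactly L steps.\<close>

lemma passage_time_trap_path:
  assumes "1 \<le> L"
  shows "passage_time L (trap_path M k) = enat (L + k * (M + 1))"
proof -
  define c where "c = k * (M + 1)"
  have path: "trap_path M k i = (if i < c then int (i mod (M + 1)) else int c - int i)" for i
    by (simp only: trap_path_def c_def)
  have "trap_path M k m \<noteq> - int L" if "m < L + c" for m
  proof (cases "m < c")
    case True
    have "0 \<le> int (m mod (M + 1))" by simp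
    then have "int (m mod (M + 1)) \<noteq> - int L" using assms by linarith
    then show ?thesis using True by (simp only: path if_True not_False_eq_True)
  next
    case False
    then show ?thesis unfolding path using that by simp
  qed
  then show ?thesis
    unfolding passage_time_def hitting_time_eq_enat_iff c_def[symmetric] by (simp add: path)
qed

text \<open>The geometric variable counts completed cycles and may be 0, so the library's convention
  fits without the shift used for the restart time. Values are in \<open>enat\<close> because a path
  may never reach the trap.\<close>

definition passage_pmf :: "real \<Rightarrow> nat \<Rightarrow> nat \<Rightarrow> enat pmf" where
  "passage_pmf p L M = map_pmf (\<lambda>k. enat (L + k * (M + 1))) (geometric_pmf p)"

lemma pmf_passage_pmf:
  assumes "0 < p" "p \<le> 1"
  shows "pmf (passage_pmf p L M) (enat (L + k * (M + 1))) = p * (1 - p) ^ k"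
proof -
  have "inj (\<lambda>k. enat (L + k * (M + 1)))"
    by (rule injI) (simp only: enat.inject add_left_cancel mult_cancel2, simp)
  from pmf_map_inj'[OF this, of "geometric_pmf p" k] show ?thesis
    using assms by (simp add: passage_pmf_def)
qed

text \<open>The event that U equals L + k(M + 1) contains the cylinder around the path with k
  cycles, of mass p(1 - p)^k. This inequality is enough, since these masses sum to 1; in particular
  U = \<infinity> has probability 0.\<close>

lemma distr_passage_time:
  assumes p: "0 < p" "p \<le> 1" and LM: "1 \<le> L" "1 \<le> M"
  shows "distr (trap_process p L M) (count_space UNIV) (passage_time L) =
           measure_pmf (passage_pmf p L M)"
proof (rule prob_space_eq_pmfI)
  interpret prob_space "trap_process p L M"
    by (rule prob_space_trap_process)
  show "prob_space (distr (trap_process p L M) (count_space UNIV) (passage_time L))"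
    by (rule prob_space_distr) measurable
  fix t
  show "emeasure (passage_pmf p L M) {t} \<le>
      emeasure (distr (trap_process p L M) (count_space UNIV) (passage_time L)) {t}"
  proof (cases "t \<in> range (\<lambda>k. enat (L + k * (M + 1)))")
    case True
    then obtain k where t: "t = enat (L + k * (M + 1))" by auto
    let ?C = "{X. \<forall>i\<le>L + k * (M + 1). X i = trap_path M k i}"
    have "emeasure (passage_pmf p L M) {t} = ennreal (p * (1 - p) ^ k)"
      using pmf_passage_pmf[OF p, of L M k] by (simp only: t emeasure_pmf_single)
    also have "\<dots> = emeasure (trap_process p L M) ?C"
      using p prod_trap_path[OF _ p(2) LM, of k]
      unfolding trap_process_def emeasure_chain_law_cylinder
      by (simp add: trap_path_def prod_ennreal del: mult_Suc_right)
    also have "\<dots> \<le> emeasure (trap_process p L M)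
        (passage_time L -` {t} \<inter> space (trap_process p L M))"
    proof (rule emeasure_mono)
      show "?C \<subseteq> passage_time L -` {t} \<inter> space (trap_process p L M)"
        using passage_time_trap_path[OF LM(1), of M k]
        unfolding t passage_time_def hitting_time_eq_enat_iff vimage_def singleton_iff
        by auto
    qed measurable
    finally show ?thesis
      by (simp add: emeasure_distr)
  next
    case False
    then have "t \<notin> set_pmf (passage_pmf p L M)"
      by (auto simp: passage_pmf_def)
    then show ?thesis
      by (simp add: emeasure_pmf_single set_pmf_iff)
  qed
qed simp

lemma nn_integral_passage_time:
  assumes "0 < p" "p \<le> 1" "1 \<le> L" "1 \<le> M"
  shows "(\<integral>\<^sup>+X. g (passage_time L X) \<partial>trap_process p L M) =
           (\<integral>\<^sup>+k. g (enat (L + k * (M + 1))) \<partial>geometric_pmf p)"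
proof -
  have "(\<integral>\<^sup>+X. g (passage_time L X) \<partial>trap_process p L M) =
      (\<integral>\<^sup>+t. g t \<partial>distr (trap_process p L M) (count_space UNIV) (passage_time L))"
    by (rule nn_integral_distr[symmetric]) auto
  then show ?thesis
    unfolding distr_passage_time[OF assms] by (simp add: passage_pmf_def)
qed

lemma expected_passage_eq:
  assumes p: "0 < p" "p \<le> 1" and LM: "1 \<le> L" "1 \<le> M"
  shows "expected_passage p L M = ennreal (real L + (1 - p) / p * (real M + 1))"
proof -
  have "expected_passage p L M =
      (\<integral>\<^sup>+k. ennreal_of_enat (enat (L + k * (M + 1))) \<partial>geometric_pmf p)"
    unfolding expected_passage_def by (rule nn_integral_passage_time[OF assms])
  also have "\<dots> = (\<integral>\<^sup>+k. ennreal (real L + (real M + 1) * real k) \<partial>geometric_pmf p)"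
    by (intro nn_integral_cong) (simp add: ennreal_of_nat_eq_real_of_nat algebra_simps)
  also have "\<dots> = ennreal (real L + (real M + 1) * ((1 - p) / p))"
    using expectation_geometric_pmf[of p] integrable_real_geometric_pmf[of p] p
    by (subst nn_integral_eq_integral) auto
  finally show ?thesis by (simp add: mult.commute)
qed

lemma passage_prob_eq_pmf:
  assumes "0 < p" "p \<le> 1" "1 \<le> L" "1 \<le> M"
  shows "passage_prob p L M n = pmf (passage_pmf p L M) (enat n)"
proof -
  have "passage_prob p L M n =
      measure (distr (trap_process p L M) (count_space UNIV) (passage_time L)) {enat n}"
    unfolding passage_prob_def
    by (subst measure_distr) (auto simp: vimage_def trap_process_def)
  then show ?thesis
    unfolding distr_passage_time[OF assms] by (simp add: measure_pmf_single)
qed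

section \<open>Generating function of the passage time\<close>

lemma cycle_sums:
  fixes p z :: real
  assumes p: "0 < p" "p \<le> 1" and z: "(1 - p) * \<bar>z\<bar> ^ (M + 1) < 1"
  shows "(\<lambda>k. p * (1 - p) ^ k * z ^ (L + k * (M + 1))) sums
           (p * z ^ L / (1 - (1 - p) * z ^ (M + 1)))"
proof -
  let ?c = "(1 - p) * z ^ (M + 1)"
  have "norm ?c < 1"
    using p z by (simp add: abs_mult power_abs)
  from sums_mult[OF geometric_sums[OF this], of "p * z ^ L"] show ?thesis
    by (simp add: power_add power_mult_distrib ac_simps flip: power_mult)
qed

text \<open>The masses vanish off the progression L + k(M + 1), so reindexing leaves a geometric
  series. As 1 - p < 1, the condition on z holds in a neighbourhood of 1, as is needed for
  derivatives there.\<close>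

lemma passage_prob_sums:
  fixes p z :: real
  assumes p: "0 < p" "p \<le> 1" and LM: "1 \<le> L" "1 \<le> M"
    and z: "(1 - p) * \<bar>z\<bar> ^ (M + 1) < 1"
  shows "(\<lambda>n. passage_prob p L M n * z ^ n) sums (p * z ^ L / (1 - (1 - p) * z ^ (M + 1)))"
proof -
  have mono: "strict_mono (\<lambda>k. L + k * (M + 1))"
    by (intro strict_monoI add_strict_left_mono mult_strict_right_mono) auto
  have "passage_prob p L M n * z ^ n = 0" if "n \<notin> range (\<lambda>k. L + k * (M + 1))" for n
  proof -
    have "enat n \<notin> set_pmf (passage_pmf p L M)"
      using that by (auto simp: passage_pmf_def)
    then show ?thesis
      by (simp add: passage_prob_eq_pmf[OF p LM] set_pmf_iff)
  qed
  then have "(\<lambda>k. passage_prob p L M (L + k * (M + 1)) * z ^ (L + k * (M + 1))) sums c \<longleftrightarrow>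
      (\<lambda>n. passage_prob p L M n * z ^ n) sums c" for c
    by (rule sums_mono_reindex[OF mono])
  then show ?thesis
    using cycle_sums[OF p z, of L]
    by (simp only: passage_prob_eq_pmf[OF p LM] pmf_passage_pmf[OF p])
qed

text \<open>The closed form is differentiated instead of the series. With c = q(M + 1)/p it gives
  u'(1) = L + c, and the terms 2c^2 cancel in 2u'(1)^2 - u''(1), leaving L(L + 1) + c(2L -
  M).\<close>

lemma restart_coeff_eq:
  assumes p: "0 < p" "p \<le> 1" and LM: "1 \<le> L" "1 \<le> M"
  shows "restart_coeff p L M =
           ((real L + 1) * real L + (1 - p) / p * (real M + 1) * (2 * real L - real M)) / 2"
proof -
  define q where "q = 1 - p"
  define S where "S = {z::real. q * \<bar>z\<bar> ^ (M + 1) < 1}"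
  \<comment> \<open>The generating function is \<open>C / B\<close>; \<open>A\<close> is the
    derivative of \<open>C\<close>, and \<open>- E\<close> that of \<open>B\<close>.\<close>
  define A B C E where "A = (\<lambda>z::real. p * real L * z ^ (L - 1))"
    and "B = (\<lambda>z::real. 1 - q * z ^ (M + 1))"
    and "C = (\<lambda>z::real. p * z ^ L)"
    and "E = (\<lambda>z::real. q * (real M + 1) * z ^ M)"
  note defs = A_def B_def C_def E_def
  have dA: "(A has_real_derivative p * real L * (real L - 1)) (at 1)"
    using LM unfolding defs by (auto intro!: derivative_eq_intros simp: of_nat_diff)
  have dB: "(B has_real_derivative - E z) (at z)" for z
    using DERIV_diff[OF DERIV_const[of 1] DERIV_cmult[OF DERIV_pow[of "M + 1" z], of q]]
    unfolding defs by (simp add: mult.assoc add.commute)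
  have dC: "(C has_real_derivative A z) (at z)" for z
    unfolding defs by (auto intro!: derivative_eq_intros)
  have dE: "(E has_real_derivative q * (real M + 1) * real M) (at 1)"
    unfolding defs by (auto intro!: derivative_eq_intros)
  define u' where "u' = (\<lambda>z. (A z * B z - C z * - E z) / (B z * B z))"
  have "open S"
    unfolding S_def by (intro open_Collect_less continuous_intros)
  have "1 \<in> S" using p by (simp add: S_def q_def)
  have nz: "B z \<noteq> 0" if "z \<in> S" for z
  proof -
    have "q * z ^ (M + 1) \<le> q * \<bar>z\<bar> ^ (M + 1)"
      using p abs_ge_self[of "z ^ (M + 1)", unfolded power_abs] by (intro mult_left_mono) (auto simp: q_def)
    then show ?thesis using that unfolding S_def B_def mem_Collect_eq by linarith
  qed
  have pgf: "C z / B z = passage_pgf p L M z" if "z \<in> S" for z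
    using passage_prob_sums[OF p LM, of z] that
    by (simp add: sums_iff passage_pgf_def S_def B_def C_def q_def)
  have du: "((\<lambda>z. C z / B z) has_real_derivative u' z) (at z)" if "z \<in> S" for z
    unfolding u'_def by (rule DERIV_divide[OF dC dB nz[OF that]])
  \<comment> \<open>Agreement on the open set \<open>S\<close>, not just at 1, allows a second
    differentiation.\<close>
  have deriv: "u' z = deriv (passage_pgf p L M) z" if "z \<in> S" for z
    using has_field_derivative_transform_within_open[OF du[OF that] \<open>open S\<close> that pgf]
    by (simp add: DERIV_imp_deriv)
  define u2 where "u2 = real L * (real L - 1) + (2 * real L * q * (real M + 1) +
      q * (real M + 1) * real M) / p + 2 * (q * (real M + 1))\<^sup>2 / p\<^sup>2"
  have at1: "A 1 = p * real L" "B 1 = p" "C 1 = p" "E 1 = q * (real M + 1)"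
    by (simp_all add: defs q_def)
  have "(u' has_real_derivative u2) (at 1)"
  proof -
    have "((\<lambda>z. A z * B z - C z * - E z) has_real_derivative
        (p * real L * (real L - 1) * B 1 + - E 1 * A 1) -
        (A 1 * - E 1 + - (q * (real M + 1) * real M) * C 1)) (at 1)"
      by (intro DERIV_diff DERIV_mult DERIV_minus dA dB dC dE)
    from DERIV_divide[OF this DERIV_mult[OF dB dB]] show ?thesis
      unfolding u'_def
      by (rule DERIV_cong) (use p in \<open>simp_all add: at1 u2_def field_simps power2_eq_square\<close>)
  qed
  from has_field_derivative_transform_within_open[OF this \<open>open S\<close> \<open>1 \<in> S\<close> deriv]
  have 2: "(deriv ^^ 2) (passage_pgf p L M) 1 = u2"
    by (simp add: DERIV_imp_deriv numeral_2_eq_2)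
  have "u' 1 = real L + q * (real M + 1) / p"
    using p by (simp add: u'_def at1 field_simps)
  then have 1: "deriv (passage_pgf p L M) 1 = real L + q * (real M + 1) / p"
    using deriv[OF \<open>1 \<in> S\<close>] by simp
  show ?thesis
    unfolding restart_coeff_def 1 2 u2_def q_def[symmetric]
    using p by (simp add: field_simps power2_eq_square)
qed

section \<open>Geometric restart\<close>

lemma suminf_ge_one_eq_top:
  fixes f :: "nat \<Rightarrow> ennreal"
  assumes "\<And>k. 1 \<le> f k"
  shows "(\<Sum>k. f k) = \<infinity>"
proof -
  have "of_nat n \<le> (\<Sum>k. f k)" for n
  proof -
    have "of_nat n = (\<Sum>k<n. 1 :: ennreal)" by simp
    also have "\<dots> \<le> (\<Sum>k<n. f k)" by (intro sum_mono assms)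
    also have "\<dots> \<le> (\<Sum>k. f k)" by (intro sum_le_suminf summableI) auto
    finally show ?thesis .
  qed
  then show ?thesis
    using ennreal_Ex_less_of_nat[of "\<Sum>k. f k"] by (metis infinity_ennreal_def leD top.not_eq_extremum)
qed

text \<open>Attempt \<open>k\<close> takes place iff all earlier ones were restarted, and then lasts \<open>min U\<^sub>k R\<^sub>k\<close>.\<close>

lemma restarted_time_eq_suminf:
  assumes pos: "\<And>k. 1 \<le> snd (\<omega> k)"
  shows "ennreal_of_enat (restarted_time \<omega>) =
     (\<Sum>k. (\<Prod>j<k. if enat (snd (\<omega> j)) \<le> fst (\<omega> j) then 1 else 0) *
           ennreal_of_enat (min (fst (\<omega> k)) (enat (snd (\<omega> k)))))"
    (is "_ = (\<Sum>k. ?P k * ?m k)")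
proof (cases "\<exists>k. enat (snd (\<omega> k)) > fst (\<omega> k)")
  case True
  define \<kappa> where "\<kappa> = (LEAST k. enat (snd (\<omega> k)) > fst (\<omega> k))"
  have \<kappa>: "enat (snd (\<omega> \<kappa>)) > fst (\<omega> \<kappa>)"
    unfolding \<kappa>_def using True by (rule LeastI_ex)
  have before: "enat (snd (\<omega> j)) \<le> fst (\<omega> j)" if "j < \<kappa>" for j
    using that not_less_Least[of j "\<lambda>k. enat (snd (\<omega> k)) > fst (\<omega> k)"]
    unfolding \<kappa>_def by (simp add: not_less)
  \<comment> \<open>The factor at j = \<kappa> vanishes, because that attempt was not
    restarted.\<close>
  have "?P k = 0" if "\<kappa> < k" for k
    using that \<kappa> by (auto simp: not_le intro!: prod_zero)
  then have "(\<Sum>k. ?P k * ?m k) = (\<Sum>k<Suc \<kappa>. ?P k * ?m k)"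
    by (intro suminf_finite) (auto simp: not_less Suc_le_eq)
  also have "\<dots> = (\<Sum>k<\<kappa>. ?P k * ?m k) + ?P \<kappa> * ?m \<kappa>"
    by simp
  also have "(\<Sum>k<\<kappa>. ?P k * ?m k) = (\<Sum>k<\<kappa>. ennreal_of_enat (enat (snd (\<omega> k))))"
  proof (intro sum.cong refl)
    fix k assume "k \<in> {..<\<kappa>}"
    then have "?P k = 1" "min (fst (\<omega> k)) (enat (snd (\<omega> k))) = enat (snd (\<omega> k))"
      using before by (auto intro!: prod.neutral simp: min_absorb2)
    then show "?P k * ?m k = ennreal_of_enat (enat (snd (\<omega> k)))" by simp
  qed
  also have "?P \<kappa> = 1"
    using before by (auto intro!: prod.neutral)
  also have "min (fst (\<omega> \<kappa>)) (enat (snd (\<omega> \<kappa>))) = fst (\<omega> \<kappa>)"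
    using \<kappa> by simp
  finally show ?thesis
    using True by (simp only: restarted_time_def Let_def \<kappa>_def[symmetric] if_True
        sum_ennreal_of_enat ennreal_of_enat_plus mult_1)
next
  case False
  then have le: "enat (snd (\<omega> k)) \<le> fst (\<omega> k)" for k by (meson not_less)
  \<comment> \<open>If every attempt is restarted, each term is a restart time, hence at least 1,
    and the series diverges in agreement with the value \<infinity> of
    \<open>restarted_time\<close>.\<close>
  have "1 \<le> ?P k * ?m k" for k
    using pos[of k] by (simp add: le min_absorb2)
  then have "(\<Sum>k. ?P k * ?m k) = \<infinity>"
    by (rule suminf_ge_one_eq_top)
  then show ?thesis
    using False by (simp add: restarted_time_def)
qed

text \<open>The integrand depends only on the coordinates up to k, so it can be integrated over a
  finite product, where it factorises. The family \<open>h\<close> merges \<open>f\<close> and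
  \<open>g\<close> into one product.\<close>

lemma nn_integral_PiM_prod_lessThan:
  fixes f g :: "'a \<Rightarrow> ennreal"
  assumes N: "prob_space N" and [measurable]: "f \<in> borel_measurable N" "g \<in> borel_measurable N"
  shows "(\<integral>\<^sup>+\<omega>. (\<Prod>j<k. f (\<omega> j)) * g (\<omega> k) \<partial>PiM UNIV (\<lambda>_ :: nat. N)) =
           (\<integral>\<^sup>+x. f x \<partial>N) ^ k * (\<integral>\<^sup>+x. g x \<partial>N)"
proof -
  interpret N: prob_space N by fact
  interpret product_prob_space "\<lambda>_ :: nat. N" UNIV ..
  define h where "h j = (if j < k then f else g)" for j
  have [measurable]: "h j \<in> borel_measurable N" for j
    by (simp add: h_def)
  have split: "(\<Prod>j\<le>k. h j (\<omega> j)) = (\<Prod>j<k. f (\<omega> j)) * g (\<omega> k)" for \<omega> :: "nat \<Rightarrow> 'a"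
    by (simp add: h_def flip: lessThan_Suc_atMost)
  have "(\<integral>\<^sup>+\<omega>. (\<Prod>j<k. f (\<omega> j)) * g (\<omega> k) \<partial>PiM UNIV (\<lambda>_ :: nat. N)) =
      (\<integral>\<^sup>+\<omega>. (\<Prod>j\<le>k. h j (restrict \<omega> {..k} j)) \<partial>PiM UNIV (\<lambda>_. N))"
    by (simp add: split[symmetric])
  also have "\<dots> = (\<integral>\<^sup>+\<omega>. (\<Prod>j\<le>k. h j (\<omega> j))
      \<partial>distr (PiM UNIV (\<lambda>_. N)) (PiM {..k} (\<lambda>_. N)) (\<lambda>\<omega>. restrict \<omega> {..k}))"
    by (rule nn_integral_distr[symmetric]) measurable
  also have "\<dots> = (\<integral>\<^sup>+\<omega>. (\<Prod>j\<le>k. h j (\<omega> j)) \<partial>PiM {..k} (\<lambda>_. N))"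
    by (subst distr_PiM_restrict_finite) auto
  also have "\<dots> = (\<Prod>j\<le>k. \<integral>\<^sup>+x. h j x \<partial>N)"
    by (rule product_nn_integral_prod) auto
  also have "\<dots> = (\<integral>\<^sup>+x. f x \<partial>N) ^ k * (\<integral>\<^sup>+x. g x \<partial>N)"
    by (simp add: h_def flip: lessThan_Suc_atMost)
  finally show ?thesis .
qed

text \<open>With countable values, every function of the pair is measurable; this covers the tests
  and minima of \<open>U\<close> and \<open>R\<close> without inspecting their form.\<close>

lemma measurable_countable_args:
  fixes F :: "'b::countable \<Rightarrow> 'c::countable \<Rightarrow> 'd"
  assumes U: "U \<in> N \<rightarrow>\<^sub>M count_space UNIV" and R: "R \<in> N \<rightarrow>\<^sub>M count_space UNIV"
    and F: "\<And>u r. F u r \<in> space K"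
  shows "(\<lambda>x. F (U x) (R x)) \<in> N \<rightarrow>\<^sub>M K"
proof (rule measurable_compose_countable[OF _ U])
  fix u
  show "(\<lambda>x. F u (R x)) \<in> N \<rightarrow>\<^sub>M K"
    by (rule measurable_compose[OF R]) (simp add: F)
qed

text \<open>Attempt k is independent of the earlier ones, so the kth term of the series has mean P(R
  \<le> U)^k E[min(U, R)]. Positivity of the restart times holds only almost surely, simultaneously
  for the countably many attempts.\<close>

lemma nn_integral_restarted_time:
  assumes N: "prob_space N"
    and U: "U \<in> N \<rightarrow>\<^sub>M count_space UNIV" and R: "R \<in> N \<rightarrow>\<^sub>M count_space UNIV"
    and pos: "AE x in N. 1 \<le> R x"
  shows "(\<integral>\<^sup>+\<omega>. ennreal_of_enat (restarted_time (\<lambda>k. (U (\<omega> k), R (\<omega> k)))) \<partial>PiM UNIV (\<lambda>_. N)) =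
     (\<Sum>k. (\<integral>\<^sup>+x. (if enat (R x) \<le> U x then 1 else 0) \<partial>N) ^ k) *
       (\<integral>\<^sup>+x. ennreal_of_enat (min (U x) (enat (R x))) \<partial>N)"
proof -
  define f where "f x = (if enat (R x) \<le> U x then 1 else 0 :: ennreal)" for x
  define g where "g x = ennreal_of_enat (min (U x) (enat (R x)))" for x
  have [measurable]: "f \<in> borel_measurable N" "g \<in> borel_measurable N"
    unfolding f_def g_def by (rule measurable_countable_args[OF U R], simp)+
  have "AE \<omega> in PiM UNIV (\<lambda>_ :: nat. N). \<forall>k. 1 \<le> R (\<omega> k)"
    unfolding AE_all_countable by (intro allI AE_PiM_component N pos UNIV_I)
  then have "(\<integral>\<^sup>+\<omega>. ennreal_of_enat (restarted_time (\<lambda>k. (U (\<omega> k), R (\<omega> k)))) \<partial>PiM UNIV (\<lambda>_. N)) =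
      (\<integral>\<^sup>+\<omega>. (\<Sum>k. (\<Prod>j<k. f (\<omega> j)) * g (\<omega> k)) \<partial>PiM UNIV (\<lambda>_. N))"
    by (intro nn_integral_cong_AE) (auto elim!: eventually_mono simp: restarted_time_eq_suminf f_def g_def)
  also have "\<dots> = (\<Sum>k. \<integral>\<^sup>+\<omega>. (\<Prod>j<k. f (\<omega> j)) * g (\<omega> k) \<partial>PiM UNIV (\<lambda>_. N))"
    by (rule nn_integral_suminf) measurable
  also have "\<dots> = (\<Sum>k. (\<integral>\<^sup>+x. f x \<partial>N) ^ k) * (\<integral>\<^sup>+x. g x \<partial>N)"
    by (simp add: nn_integral_PiM_prod_lessThan[OF N])
  finally show ?thesis unfolding f_def g_def .
qed

section \<open>Integrals for a single attempt\<close>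

lemma nn_integral_geometric_less:
  assumes "0 < \<rho>" "\<rho> < 1"
  shows "(\<integral>\<^sup>+k. (if k < n then 1 else 0) \<partial>geometric_pmf \<rho>) = ennreal (1 - (1 - \<rho>) ^ n)"
proof -
  have "(\<integral>\<^sup>+k. (if k < n then 1 else 0) \<partial>geometric_pmf \<rho>) =
      (\<integral>\<^sup>+k. indicator {..<n} k \<partial>geometric_pmf \<rho>)"
    by (intro nn_integral_cong) (simp add: indicator_def)
  also have "\<dots> = ennreal (\<Sum>k<n. (1 - \<rho>) ^ k * \<rho>)"
    using assms by (simp add: emeasure_measure_pmf_finite sum_ennreal)
  also have "(\<Sum>k<n. (1 - \<rho>) ^ k * \<rho>) = 1 - (1 - \<rho>) ^ n"
    using assms by (simp add: sum_distrib_right[symmetric] sum_gp_strict)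
  finally show ?thesis .
qed

lemma nn_integral_geometric_ge:
  assumes "0 < \<rho>" "\<rho> < 1"
  shows "(\<integral>\<^sup>+k. (if n \<le> k then 1 else 0) \<partial>geometric_pmf \<rho>) = ennreal ((1 - \<rho>) ^ n)"
proof -
  let ?f = "\<lambda>k :: nat. if k < n then 1 else 0 :: ennreal"
  have "(\<integral>\<^sup>+k. (if n \<le> k then 1 else 0) \<partial>geometric_pmf \<rho>) = (\<integral>\<^sup>+k. 1 - ?f k \<partial>geometric_pmf \<rho>)"
    by (intro nn_integral_cong) auto
  also have "\<dots> = 1 - (\<integral>\<^sup>+k. ?f k \<partial>geometric_pmf \<rho>)"
    using nn_integral_geometric_less[OF assms, of n] by (subst nn_integral_diff) auto
  also have "\<dots> = ennreal ((1 - \<rho>) ^ n)"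
    using assms unfolding nn_integral_geometric_less[OF assms]
    by (simp add: ennreal_minus power_le_one flip: ennreal_1)
  finally show ?thesis .
qed

lemma nn_integral_restart_le:
  assumes "0 < \<rho>" "\<rho> < 1"
  shows "(\<integral>\<^sup>+r. (if r \<le> n then 1 else 0) \<partial>restart_pmf \<rho>) = ennreal (1 - (1 - \<rho>) ^ n)"
  using nn_integral_geometric_less[OF assms, of n] by (simp add: restart_pmf_def Suc_le_eq)

text \<open>E[min(n, R)] is the sum of the tails P(R > i) = (1 - \<rho>)^i over i < n; the induction
  adds one tail at a time. With R = k + 1, the event R > n reads \<open>n \<le> k\<close>.\<close>

lemma nn_integral_restart_min:
  assumes "0 < \<rho>" "\<rho> < 1"
  shows "(\<integral>\<^sup>+r. of_nat (min n r) \<partial>restart_pmf \<rho>) = ennreal ((1 - (1 - \<rho>) ^ n) / \<rho>)"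
proof -
  have "(\<integral>\<^sup>+k. of_nat (min n (Suc k)) \<partial>geometric_pmf \<rho>) = ennreal (\<Sum>i<n. (1 - \<rho>) ^ i)"
  proof (induction n)
    case (Suc n)
    have "(\<integral>\<^sup>+k. of_nat (min (Suc n) (Suc k)) \<partial>geometric_pmf \<rho>) =
        (\<integral>\<^sup>+k. of_nat (min n (Suc k)) + (if n \<le> k then 1 else 0) \<partial>geometric_pmf \<rho>)"
    proof (intro nn_integral_cong)
      fix k
      have "min (Suc n) (Suc k) = min n (Suc k) + (if n \<le> k then 1 else 0)" by auto
      then show "of_nat (min (Suc n) (Suc k)) =
          of_nat (min n (Suc k)) + (if n \<le> k then 1 else 0 :: ennreal)" by simp
    qed
    also have "\<dots> = ennreal (\<Sum>i<n. (1 - \<rho>) ^ i) + ennreal ((1 - \<rho>) ^ n)"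
      using nn_integral_geometric_ge[OF assms, of n] Suc.IH by (subst nn_integral_add) auto
    also have "\<dots> = ennreal (\<Sum>i<Suc n. (1 - \<rho>) ^ i)"
      using assms by (simp add: sum_nonneg)
    finally show ?case .
  qed simp
  then show ?thesis
    using assms by (simp add: restart_pmf_def sum_gp_strict)
qed

text \<open>This is E[1 - r^U] = 1 - u(r), which for r = 1 - \<rho> is the probability that an
  attempt is restarted.\<close>

lemma nn_integral_cycle_geometric:
  assumes p: "0 < p" "p \<le> 1" and r: "0 \<le> r" "r \<le> 1"
  shows "(\<integral>\<^sup>+k. ennreal (1 - r ^ (L + k * (M + 1))) \<partial>geometric_pmf p) =
           ennreal (1 - p * r ^ L / (1 - (1 - p) * r ^ (M + 1)))"
proof -
  let ?f = "\<lambda>k. p * (1 - p) ^ k * (1 - r ^ (L + k * (M + 1)))"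
  have "(1 - p) * r ^ (M + 1) \<le> 1 - p"
    using p r by (intro mult_left_le power_le_one) auto
  then have z: "(1 - p) * \<bar>r\<bar> ^ (M + 1) < 1"
    using p r by (simp only: abs_of_nonneg)
  \<comment> \<open>The instance L = 0, z = 1 of the cycle series gives total mass 1.\<close>
  have "(\<lambda>k. p * (1 - p) ^ k) sums 1"
    using cycle_sums[of p 1 0 M] p by simp
  from sums_diff[OF this cycle_sums[OF p z, of L]]
  have "?f sums (1 - p * r ^ L / (1 - (1 - p) * r ^ (M + 1)))"
    by (simp only: right_diff_distrib mult_1_right)
  moreover have "0 \<le> ?f k" for k
    using p r power_le_one[of r "L + k * (M + 1)"] by (intro mult_nonneg_nonneg) auto
  ultimately have "(\<Sum>k. ennreal (?f k)) = ennreal (1 - p * r ^ L / (1 - (1 - p) * r ^ (M + 1)))"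
    by (intro suminf_ennreal_eq)
  moreover have "(\<integral>\<^sup>+k. ennreal (1 - r ^ (L + k * (M + 1))) \<partial>geometric_pmf p) = (\<Sum>k. ennreal (?f k))"
    using p r
    by (subst nn_integral_measure_pmf)
       (simp add: nn_integral_count_space_nat mult.commute power_le_one flip: ennreal_mult')
  ultimately show ?thesis by simp
qed

lemma nn_integral_attempt:
  fixes F :: "enat \<Rightarrow> nat \<Rightarrow> ennreal"
  assumes "0 < p" "p \<le> 1" "1 \<le> L" "1 \<le> M"
  shows "(\<integral>\<^sup>+x. F (passage_time L (fst x)) (snd x) \<partial>(trap_process p L M \<Otimes>\<^sub>M measure_pmf Q)) =
           (\<integral>\<^sup>+k. \<integral>\<^sup>+r. F (enat (L + k * (M + 1))) r \<partial>Q \<partial>geometric_pmf p)"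
proof -
  have "(\<integral>\<^sup>+x. F (passage_time L (fst x)) (snd x) \<partial>(trap_process p L M \<Otimes>\<^sub>M measure_pmf Q)) =
      (\<integral>\<^sup>+X. \<integral>\<^sup>+r. F (passage_time L X) r \<partial>Q \<partial>trap_process p L M)"
    by (subst measure_pmf.nn_integral_fst[symmetric])
       (auto intro!: measurable_countable_args measurable_compose[OF measurable_fst]
          measurable_compose[OF measurable_snd])
  also have "\<dots> = (\<integral>\<^sup>+k. \<integral>\<^sup>+r. F (enat (L + k * (M + 1))) r \<partial>Q \<partial>geometric_pmf p)"
    by (rule nn_integral_passage_time[OF assms])
  finally show ?thesis .
qed

lemma expected_restarted_eq:
  assumes p: "0 < p" "p \<le> 1" and LM: "1 \<le> L" "1 \<le> M" and \<rho>: "0 < \<rho>" "\<rho> < 1"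
  shows "expected_restarted p L M \<rho> = ennreal (restart_mean p L M \<rho>)"
proof -
  \<comment> \<open>The generating function at 1 - \<rho>. Because ties are restarts, P(R > n) = (1
    - \<rho>)^n with no shift in the exponent, so u is exactly the probability that an attempt
    succeeds.\<close>
  define u where "u = p * (1 - \<rho>) ^ L / (1 - (1 - p) * (1 - \<rho>) ^ (M + 1))"
  let ?N = "trap_process p L M \<Otimes>\<^sub>M measure_pmf (restart_pmf \<rho>)"
  have N: "prob_space ?N"
    by (intro prob_space_pair prob_space_trap_process measure_pmf.prob_space_axioms)
  have U: "(\<lambda>x. passage_time L (fst x)) \<in> ?N \<rightarrow>\<^sub>M count_space UNIV"
    by (rule measurable_compose[OF measurable_fst measurable_passage_time])
  have R: "snd \<in> ?N \<rightarrow>\<^sub>M count_space UNIV"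
    by (rule measurable_compose[OF measurable_snd, of "\<lambda>r. r", simplified]) simp
  have "(1 - p) * (1 - \<rho>) ^ (M + 1) \<le> 1 - p"
    using p \<rho> by (intro mult_left_le power_le_one) auto
  \<comment> \<open>The denominator of u is at least p, hence positive, and it also dominates the
    numerator; so 0 < u \<le> 1 and the series over attempts converges to 1/u.\<close>
  then have d: "p \<le> 1 - (1 - p) * (1 - \<rho>) ^ (M + 1)" by simp
  have u0: "0 < u"
    unfolding u_def using p \<rho> d by (intro divide_pos_pos mult_pos_pos) auto
  have "p * (1 - \<rho>) ^ L \<le> p * 1"
    using p \<rho> by (intro mult_left_mono power_le_one) auto
  then have "p * (1 - \<rho>) ^ L \<le> 1 - (1 - p) * (1 - \<rho>) ^ (M + 1)"
    using d by linarith
  moreover have "0 < 1 - (1 - p) * (1 - \<rho>) ^ (M + 1)"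
    using d p by linarith
  ultimately have u1: "u \<le> 1"
    by (simp only: u_def divide_le_eq_1_pos)
  have le: "(\<integral>\<^sup>+x. (if enat (snd x) \<le> passage_time L (fst x) then 1 else 0) \<partial>?N) = ennreal (1 - u)"
    unfolding nn_integral_attempt[OF p LM, where F = "\<lambda>t r. if enat r \<le> t then 1 else 0"]
      enat_ord_simps nn_integral_restart_le[OF \<rho>] u_def
    using p \<rho> by (intro nn_integral_cycle_geometric) auto
  have min: "(\<integral>\<^sup>+x. ennreal_of_enat (min (passage_time L (fst x)) (enat (snd x))) \<partial>?N) =
      ennreal ((1 - u) / \<rho>)"
  proof -
    have "ennreal_of_enat (min (enat n) (enat r)) = of_nat (min n r)" for n r
      by (simp add: min_def)
    then have "(\<integral>\<^sup>+x. ennreal_of_enat (min (passage_time L (fst x)) (enat (snd x))) \<partial>?N) =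
        (\<integral>\<^sup>+k. ennreal (1 / \<rho>) * ennreal (1 - (1 - \<rho>) ^ (L + k * (M + 1))) \<partial>geometric_pmf p)"
      unfolding nn_integral_attempt[OF p LM, where F = "\<lambda>t r. ennreal_of_enat (min t (enat r))"]
      using \<rho> by (simp add: nn_integral_restart_min power_le_one flip: ennreal_mult'')
    also have "\<dots> = ennreal (1 / \<rho>) * ennreal (1 - u)"
      using p \<rho> unfolding u_def
      by (subst nn_integral_cmult) (simp_all only: nn_integral_cycle_geometric, simp_all)
    also have "\<dots> = ennreal ((1 - u) / \<rho>)"
      using \<rho> u1 by (simp flip: ennreal_mult'')
    finally show ?thesis .
  qed
  have "AE x in ?N. 1 \<le> snd x"
  proof -
    interpret pair_prob_space "trap_process p L M" "measure_pmf (restart_pmf \<rho>)"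
      unfolding pair_prob_space_def pair_sigma_finite_def
      by (intro conjI prob_space_imp_sigma_finite prob_space_trap_process measure_pmf.prob_space_axioms)
    have "snd -` {1..} \<inter> space ?N = {x \<in> space ?N. 1 \<le> snd x}"
      by auto
    then have "{x \<in> space ?N. 1 \<le> snd x} \<in> sets ?N"
      using measurable_sets[OF R, of "{1..}"] by simp
    then show ?thesis
      by (rule AE_pair_measure) (auto simp: AE_measure_pmf_iff restart_pmf_def)
  qed
  then have "expected_restarted p L M \<rho> = (\<Sum>k. ennreal (1 - u) ^ k) * ennreal ((1 - u) / \<rho>)"
    unfolding expected_restarted_def restart_space_def
    by (subst nn_integral_restarted_time[OF N U R]) (simp_all only: le min)
  also have "(\<Sum>k. ennreal (1 - u) ^ k) = ennreal (1 / u)"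
  proof -
    have "(\<lambda>k. (1 - u) ^ k) sums (1 / u)"
      using geometric_sums[of "1 - u"] u0 u1 by simp
    then have "(\<Sum>k. ennreal ((1 - u) ^ k)) = ennreal (1 / u)"
      using u1 by (intro suminf_ennreal_eq) auto
    then show ?thesis
      using u1 by (simp only: ennreal_power diff_ge_0_iff_ge)
  qed
  also have "ennreal (1 / u) * ennreal ((1 - u) / \<rho>) = ennreal ((1 - u) / (\<rho> * u))"
    using u0 \<rho> u1 by (subst ennreal_mult[symmetric]) (simp_all add: mult.commute)
  finally show ?thesis
    using restart_mean_eq[OF p \<rho> u_def] by simp
qed

section \<open>The restart criterion\<close>

lemma restart_mean_nonneg:
  assumes "0 < p" "p \<le> 1"
  shows "0 \<le> restart_mean p L M \<rho>"
  using assms unfolding restart_mean_def by (intro add_nonneg_nonneg mult_nonneg_nonneg sum_nonneg) auto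

lemma expected_restarted_less_iff:
  assumes p: "0 < p" "p \<le> 1" and LM: "1 \<le> L" "1 \<le> M" and \<rho>: "\<rho> \<in> {0<..<1}"
  shows "expected_restarted p L M \<rho> < expected_passage p L M \<longleftrightarrow>
           restart_mean p L M \<rho> < restart_mean p L M 0"
  using expected_restarted_eq[OF p LM, of \<rho>] expected_passage_eq[OF p LM] \<rho>
    restart_mean_nonneg[OF p, of L M \<rho>]
  by (simp add: restart_mean_at_0 ennreal_less_iff)

lemma restart_beneficial_near_0:
  assumes p: "0 < p" "p \<le> 1" and LM: "1 \<le> L" "1 \<le> M" and D: "restart_coeff p L M < 0"
  shows "\<exists>\<rho>'\<in>{0<..<1}. \<forall>\<rho>\<in>{0<..<\<rho>'}. expected_restarted p L M \<rho> < expected_passage p L M"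
proof -
  obtain d where d: "0 < d" "\<And>h. 0 < h \<Longrightarrow> h < d \<Longrightarrow> restart_mean p L M h < restart_mean p L M 0"
    using DERIV_neg_dec_right[OF restart_mean_has_derivative_at_0[of p L M]] D
    unfolding restart_coeff_eq[OF p LM] by auto
  have "expected_restarted p L M \<rho> < expected_passage p L M" if "\<rho> \<in> {0<..<min d (1 / 2)}" for \<rho>
    using that d(2)[of \<rho>] by (subst expected_restarted_less_iff[OF p LM]) auto
  \<comment> \<open>The decrease may be known beyond 1; the cap 1/2 keeps the interval inside
    (0,1).\<close>
  then show ?thesis
    using d(1) by (intro bexI[of _ "min d (1 / 2)"]) auto
qed

text \<open>A convex graph lies above its tangent at 0, so D \<ge> 0 would exclude any value below
  the one at 0. A single beneficial \<rho> suffices, which settles the converse directions of both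
  equivalences.\<close>

lemma restart_beneficial_imp_coeff_neg:
  assumes p: "0 < p" "p \<le> 1" and LM: "1 \<le> L" "1 \<le> M" and \<rho>: "\<rho> \<in> {0<..<1}"
    and less: "expected_restarted p L M \<rho> < expected_passage p L M"
  shows "restart_coeff p L M < 0"
proof (rule ccontr)
  assume "\<not> restart_coeff p L M < 0"
  then have "0 \<le> restart_coeff p L M * (\<rho> - 0)"
    using \<rho> by simp
  also have "\<dots> \<le> restart_mean p L M \<rho> - restart_mean p L M 0"
    unfolding restart_coeff_eq[OF p LM]
    by (rule convex_on_imp_above_tangent[OF convex_on_restart_mean[OF p] _ _ _
          has_field_derivative_at_within[OF restart_mean_has_derivative_at_0]])
       (use \<rho> in \<open>auto simp: interior_open\<close>)
  finally show False
    using less unfolding expected_restarted_less_iff[OF p LM \<rho>] by simp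
qed

theorem mainTheorem6:
  fixes L M :: nat and p q :: real
  assumes "1 \<le> L" and "1 \<le> M" and "0 \<le> p" and "p \<le> 1" and "q = 1 - p" and "q \<noteq> 1"
  shows
    "(\<forall>z::real. q * \<bar>z\<bar> ^ (M + 1) < 1 \<longrightarrow>
        (\<lambda>n. passage_prob p L M n * z ^ n) sums (p * z ^ L / (1 - q * z ^ (M + 1))))
   \<and> expected_passage p L M < \<infinity>
   \<and> (\<forall>\<rho>\<in>{0<..<1}. expected_restarted p L M \<rho> < \<infinity>)
   \<and> convex_on {0<..<1} (\<lambda>\<rho>. enn2real (expected_restarted p L M \<rho>))
   \<and> ((\<exists>a b. 0 \<le> a \<and> a < b \<and> b \<le> 1 \<and>
          (\<forall>\<rho>\<in>{a<..<b}. expected_restarted p L M \<rho> < expected_passage p L M))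
        \<longleftrightarrow> restart_coeff p L M < 0)
   \<and> (restart_coeff p L M < 0 \<longleftrightarrow>
        (\<exists>\<rho>'\<in>{0<..<1}. \<forall>\<rho>\<in>{0<..<\<rho>'}. expected_restarted p L M \<rho> < expected_passage p L M))
   \<and> (restart_coeff p L M < 0 \<longleftrightarrow>
        (real L + 1) * real L + q / p * (real M + 1) * (2 * real L - real M) < 0)
   \<and> ((real L + 1) * real L + q / p * (real M + 1) * (2 * real L - real M) < 0 \<longleftrightarrow>
        p < p_star L M)
   \<and> (\<forall>l m :: nat. 1 \<le> l \<and> m = 2 * l \<longrightarrow> p_star l m = 0)
   \<and> (\<forall>l m l' m' :: nat. 1 \<le> l \<and> 1 \<le> l' \<and> 2 * l \<le> m \<and> m \<le> m' \<and>
          real m / real l < real m' / real l' \<longrightarrow> p_star l m < p_star l' m')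
   \<and> (\<forall>\<epsilon>>0. \<exists>r. \<forall>l m :: nat. 1 \<le> l \<and> 1 \<le> m \<and> r \<le> real m / real l \<longrightarrow>
          1 - \<epsilon> < p_star l m \<and> p_star l m < 1)
   \<and> (\<forall>l m :: nat. 1 \<le> l \<and> 1 \<le> m \<and> real m / real l > 2 \<longrightarrow>
          0 < p_star l m \<and>
          (\<exists>a b. 0 \<le> a \<and> a < b \<and> b \<le> 1 \<and>
             (\<forall>p'\<in>{a<..<b}. \<exists>\<rho>\<in>{0<..<1}.
                expected_restarted p' l m \<rho> < expected_passage p' l m)))"
proof -
  have p: "0 < p" "p \<le> 1" and q: "q = 1 - p" using assms by auto
  note LM = assms(1,2)
  have near0: "\<exists>\<rho>'\<in>{0<..<1}. \<forall>\<rho>\<in>{0<..<\<rho>'}. expected_restarted p L M \<rho> < expected_passage p L M"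
    if "restart_coeff p L M < 0"
    by (rule restart_beneficial_near_0[OF p LM that])
  have D: "restart_coeff p L M < 0 \<longleftrightarrow>
      (real L + 1) * real L + q / p * (real M + 1) * (2 * real L - real M) < 0"
    unfolding restart_coeff_eq[OF p LM] q by simp
  show ?thesis
  proof (intro conjI)
    show "\<forall>z::real. q * \<bar>z\<bar> ^ (M + 1) < 1 \<longrightarrow>
        (\<lambda>n. passage_prob p L M n * z ^ n) sums (p * z ^ L / (1 - q * z ^ (M + 1)))"
      using passage_prob_sums[OF p LM] by (simp only: q, blast)
    show "expected_passage p L M < \<infinity>"
      by (simp add: expected_passage_eq[OF p LM])
    show "\<forall>\<rho>\<in>{0<..<1}. expected_restarted p L M \<rho> < \<infinity>"
      by (simp add: expected_restarted_eq[OF p LM])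
    have conv: "convex_on {0<..<1} (restart_mean p L M)"
      by (rule convex_on_subset[OF convex_on_restart_mean[OF p]]) auto
    have eq: "enn2real (expected_restarted p L M \<rho>) = restart_mean p L M \<rho>" if "\<rho> \<in> {0<..<1}" for \<rho>
      using that by (simp add: expected_restarted_eq[OF p LM] restart_mean_nonneg[OF p])
    show "convex_on {0<..<1} (\<lambda>\<rho>. enn2real (expected_restarted p L M \<rho>))"
    proof (rule convex_onI)
      fix t x y :: real
      assume t: "0 < t" "t < 1" and xy: "x \<in> {0<..<1}" "y \<in> {0<..<1}"
      \<comment> \<open>The closed form is valid only on (0,1), so the convex combination must be
        placed there before rewriting.\<close>
      have "(1 - t) *\<^sub>R x + t *\<^sub>R y \<in> {0<..<1}"
        by (rule convexD[OF convex_real_interval(8)]) (use t xy in auto)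
      then show "enn2real (expected_restarted p L M ((1 - t) *\<^sub>R x + t *\<^sub>R y)) \<le>
          (1 - t) * enn2real (expected_restarted p L M x) + t * enn2real (expected_restarted p L M y)"
        using convex_onD[OF conv _ _ xy, of t] t xy by (simp only: eq)
    qed simp
    show "(\<exists>a b. 0 \<le> a \<and> a < b \<and> b \<le> 1 \<and>
          (\<forall>\<rho>\<in>{a<..<b}. expected_restarted p L M \<rho> < expected_passage p L M))
        \<longleftrightarrow> restart_coeff p L M < 0"
    proof (intro iffI; (elim exE conjE)?)
      fix a b :: real
      assume ab: "0 \<le> a" "a < b" "b \<le> 1"
        and "\<forall>\<rho>\<in>{a<..<b}. expected_restarted p L M \<rho> < expected_passage p L M"
      then have "expected_restarted p L M ((a + b) / 2) < expected_passage p L M" by auto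
      then show "restart_coeff p L M < 0"
        using ab by (intro restart_beneficial_imp_coeff_neg[OF p LM, of "(a + b) / 2"]) auto
    next
      assume "restart_coeff p L M < 0"
      from near0[OF this] obtain b where "b \<in> {0<..<1}"
        "\<forall>\<rho>\<in>{0<..<b}. expected_restarted p L M \<rho> < expected_passage p L M" ..
      then show "\<exists>a b. 0 \<le> a \<and> a < b \<and> b \<le> 1 \<and>
          (\<forall>\<rho>\<in>{a<..<b}. expected_restarted p L M \<rho> < expected_passage p L M)"
        by (intro exI[of _ 0] exI[of _ b]) auto
    qed
    show "restart_coeff p L M < 0 \<longleftrightarrow>
        (\<exists>\<rho>'\<in>{0<..<1}. \<forall>\<rho>\<in>{0<..<\<rho>'}. expected_restarted p L M \<rho> < expected_passage p L M)"
    proof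
      assume "\<exists>\<rho>'\<in>{0<..<1}. \<forall>\<rho>\<in>{0<..<\<rho>'}. expected_restarted p L M \<rho> < expected_passage p L M"
      then obtain \<rho>' where "\<rho>' \<in> {0<..<1}"
        "\<forall>\<rho>\<in>{0<..<\<rho>'}. expected_restarted p L M \<rho> < expected_passage p L M" ..
      then show "restart_coeff p L M < 0"
        by (intro restart_beneficial_imp_coeff_neg[OF p LM, of "\<rho>' / 2"]) auto
    qed (rule near0)
    show "restart_coeff p L M < 0 \<longleftrightarrow>
        (real L + 1) * real L + q / p * (real M + 1) * (2 * real L - real M) < 0"
      by (rule D)
    show "(real L + 1) * real L + q / p * (real M + 1) * (2 * real L - real M) < 0 \<longleftrightarrow>
        p < p_star L M"
      unfolding q by (rule critical_iff_less_p_star[OF p(1) LM(1)])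
    show "\<forall>l m :: nat. 1 \<le> l \<and> m = 2 * l \<longrightarrow> p_star l m = 0"
      by (simp add: p_star_def)
    show "\<forall>l m l' m' :: nat. 1 \<le> l \<and> 1 \<le> l' \<and> 2 * l \<le> m \<and> m \<le> m' \<and>
          real m / real l < real m' / real l' \<longrightarrow> p_star l m < p_star l' m'"
      using p_star_strict_mono by blast
    show "\<forall>\<epsilon>>0. \<exists>r. \<forall>l m :: nat. 1 \<le> l \<and> 1 \<le> m \<and> r \<le> real m / real l \<longrightarrow>
          1 - \<epsilon> < p_star l m \<and> p_star l m < 1"
    proof (intro allI impI)
      fix \<epsilon> :: real assume "0 < \<epsilon>"
      then show "\<exists>r. \<forall>l m :: nat. 1 \<le> l \<and> 1 \<le> m \<and> r \<le> real m / real l \<longrightarrow>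
          1 - \<epsilon> < p_star l m \<and> p_star l m < 1"
        using p_star_near_one p_star_less_one by (intro exI[of _ "2 + 1 / \<epsilon>"]) blast
    qed
    show "\<forall>l m :: nat. 1 \<le> l \<and> 1 \<le> m \<and> real m / real l > 2 \<longrightarrow>
          0 < p_star l m \<and>
          (\<exists>a b. 0 \<le> a \<and> a < b \<and> b \<le> 1 \<and>
             (\<forall>p'\<in>{a<..<b}. \<exists>\<rho>\<in>{0<..<1}.
                expected_restarted p' l m \<rho> < expected_passage p' l m))"
    proof (intro allI impI)
      fix l m :: nat
      assume lm: "1 \<le> l \<and> 1 \<le> m \<and> real m / real l > 2"
      then have l: "1 \<le> l" "1 \<le> m" and m: "2 * l < m" by (auto simp: pos_less_divide_eq)
      have pos: "0 < p_star l m" by (rule p_star_pos[OF l(1) m])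
      have lt1: "p_star l m < 1" using m by (intro p_star_less_one[OF l(1)]) simp
      have "\<exists>\<rho>\<in>{0<..<1}. expected_restarted p' l m \<rho> < expected_passage p' l m"
        if "p' \<in> {0<..<p_star l m}" for p'
      proof -
        have p': "0 < p'" "p' \<le> 1" using that lt1 by auto
        have "restart_coeff p' l m < 0"
          using critical_iff_less_p_star[OF p'(1) l(1), of m] that
          unfolding restart_coeff_eq[OF p' l] by simp
        from restart_beneficial_near_0[OF p' l this] obtain \<rho>' where "\<rho>' \<in> {0<..<1}"
          "\<forall>\<rho>\<in>{0<..<\<rho>'}. expected_restarted p' l m \<rho> < expected_passage p' l m" ..
        then show ?thesis by (intro bexI[of _ "\<rho>' / 2"]) auto
      qed
      then show "0 < p_star l m \<and> (\<exists>a b. 0 \<le> a \<and> a < b \<and> b \<le> 1 \<and>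
             (\<forall>p'\<in>{a<..<b}. \<exists>\<rho>\<in>{0<..<1}.
                expected_restarted p' l m \<rho> < expected_passage p' l m))"
        using pos lt1 by (intro conjI exI[of _ 0] exI[of _ "p_star l m"]) auto
    qed
  qed
qed

end
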